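(* Let $V\cong\mathbb{C}^n$ be a complex vector space of dimension $n$ with a fixed basis, and let $\mathcal{L}$ be the linear system of quadrics in $\mathbb{P}(V)$ associated to a general cyclic-symmetric tensor $T\in\operatorname{N}_1V$. Then $\mathcal{L}$ has (exactly) $J_n$ base points, where $J_n$ is the $n$-th Jacobsthal number. In particular, the Weddle locus $W(\mathcal{L})$ has at least $J_n$ singular points.
   Context: We work over $\mathbb{C}$. Let $V$ have dimension $n$ with fixed basis $e_0,\dots,e_{n-1}$, and let $[x_0:\dots:x_{n-1}]$ be the corresponding homogeneous coordinates on $\mathbb{P}(V)\cong\mathbb{P}^{n-1}$. A tensor $T\in V^{\otimes3}$ is written $T=\sum T_{ijk}\,e_i\otimes e_j\otimes e_k$. The space $\operatorname{N}_1V\subset V^{\otimes 3}$ of cyclic-symmetric tensors is the linear subspace defined by the equations $T_{ijk}+T_{jki}+T_{kij}=0$ and $T_{ijk}=T_{jik}$ for all $i,j,k$. "General" means: for all $T$ in some nonempty Zariski open subset of $\operatorname{N}_1V$. For $0\le k\le n-1$, the $k$-th face of $T$ is the symmetric matrix $T_k$ with $(T_k)_{ij}=T_{ijk}$, which represents the quadratic form $Q_k=\sum_{i,j}T_{ijk}x_ix_j$. The linear system $\mathcal{L}$ associated to $T$ is the one generated by $Q_0,\dots,Q_{n-1}$; its base points are the points of $\mathbb{P}(V)$ at which all the $Q_k$ vanish. The Weddle locus of $\mathcal{L}$ is $W(\mathcal{L})=\{P\in\mathbb{P}(V):\det\mathbf{W}_{\mathcal{L}}|_P=0\}$, where $\mathbf{W}_{\mathcal{L}}=\big[\partial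 Q_k/\partial x_i\big]_{i,k}$; a singular point of $W(\mathcal{L})$ is a point at which all the partial derivatives of $\det\mathbf{W}_{\mathcal{L}}$ vanish. The Jacobsthal numbers are defined by $J_0=0$, $J_1=1$, $J_n=J_{n-1}+2J_{n-2}$ for $n>1$. *)

theory Defs
  imports "HOL-Analysis.Analysis"
begin

text \<open>
  The vector space V is \<open>complex ^ 'n\<close> with its standard basis, so that its dimension is
  \<open>CARD('n)\<close>; tensors of order three are stored by their coordinates \<open>T $ (i, j, k)\<close>.
\<close>

fun jacobsthal :: "nat \<Rightarrow> nat" where
  "jacobsthal 0 = 0"
| "jacobsthal (Suc 0) = 1"
| "jacobsthal (Suc (Suc n)) = jacobsthal (Suc n) + 2 * jacobsthal n"

type_synonym 'n tensor3 = "complex ^ ('n \<times> 'n \<times> 'n)"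

definition cyclic_symmetric_tensors :: "('n::finite) tensor3 set" where
  "cyclic_symmetric_tensors =
    {T. \<forall>i j k. T $ (i, j, k) + T $ (j, k, i) + T $ (k, i, j) = 0 \<and> T $ (i, j, k) = T $ (j, i, k)}"


text \<open>Polynomial functions on affine space and the Zariski topology induced on a subset of it.\<close>

inductive complex_poly_fun :: "(complex ^ 'm \<Rightarrow> complex) \<Rightarrow> bool" where
  const: "complex_poly_fun (\<lambda>x. c)"
| coord: "complex_poly_fun (\<lambda>x. x $ i)"
| add: "complex_poly_fun f \<Longrightarrow> complex_poly_fun g \<Longrightarrow> complex_poly_fun (\<lambda>x. f x + g x)"
| mult: "complex_poly_fun f \<Longrightarrow> complex_poly_fun g \<Longrightarrow> complex_poly_fun (\<lambda>x. f x * g x)"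

definition zariski_open_in :: "(complex ^ 'm) set \<Rightarrow> (complex ^ 'm) set \<Rightarrow> bool" where
  "zariski_open_in X U \<longleftrightarrow>
    (\<exists>F. (\<forall>f\<in>F. complex_poly_fun f) \<and> U = X - {x. \<forall>f\<in>F. f x = 0})"


text \<open>
  Points of the projective space P(V) are the complex lines through the origin of V.
  The nonzero vectors of such a line are its homogeneous coordinate vectors; the predicate
  \<open>vanishes_at\<close> is only applied to homogeneous polynomials.
\<close>

definition proj_space :: "(complex ^ 'n::finite) set set" where
  "proj_space = {P. vec.subspace P \<and> vec.dim P = 1}"

definition vanishes_at :: "(complex ^ 'n \<Rightarrow> complex) \<Rightarrow> (complex ^ 'n) set \<Rightarrow> bool" where
  "vanishes_at f P \<longleftrightarrow> (\<forall>x\<in>P. x \<noteq> 0 \<longrightarrow> f x = 0)"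

definition partial_deriv :: "'n \<Rightarrow> (complex ^ 'n \<Rightarrow> complex) \<Rightarrow> complex ^ 'n \<Rightarrow> complex" where
  "partial_deriv i f x = deriv (\<lambda>t. f (\<chi> j. if j = i then t else x $ j)) (x $ i)"


definition face :: "('n::finite) tensor3 \<Rightarrow> 'n \<Rightarrow> complex ^ 'n ^ 'n" where
  "face T k = (\<chi> i j. T $ (i, j, k))"

definition quadric :: "('n::finite) tensor3 \<Rightarrow> 'n \<Rightarrow> complex ^ 'n \<Rightarrow> complex" where
  "quadric T k x = (\<Sum>i\<in>UNIV. \<Sum>j\<in>UNIV. face T k $ i $ j * x $ i * x $ j)"

text \<open>
  A linear system is given by its family of generators \<open>Q\<close>, indexed like the coordinates; the
  linear system associated to a tensor \<open>T\<close> is given by \<open>quadric T\<close>.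
\<close>

definition base_points :: "('n \<Rightarrow> complex ^ 'n::finite \<Rightarrow> complex) \<Rightarrow> (complex ^ 'n) set set" where
  "base_points Q = {P \<in> proj_space. \<forall>k. vanishes_at (Q k) P}"

definition weddle_matrix ::
  "('n \<Rightarrow> complex ^ 'n::finite \<Rightarrow> complex) \<Rightarrow> complex ^ 'n \<Rightarrow> complex ^ 'n ^ 'n" where
  "weddle_matrix Q x = (\<chi> i k. partial_deriv i (Q k) x)"

definition weddle_locus :: "('n \<Rightarrow> complex ^ 'n::finite \<Rightarrow> complex) \<Rightarrow> (complex ^ 'n) set set" where
  "weddle_locus Q = {P \<in> proj_space. vanishes_at (\<lambda>x. det (weddle_matrix Q x)) P}"

definition weddle_singular_points ::
  "('n \<Rightarrow> complex ^ 'n::finite \<Rightarrow> complex) \<Rightarrow> (complex ^ 'n) set set" where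
  "weddle_singular_points Q =
    {P \<in> weddle_locus Q. \<forall>i. vanishes_at (partial_deriv i (\<lambda>x. det (weddle_matrix Q x))) P}"

end

theory Submission
  imports Defs
begin

text \<open>
  The quadrics of a cyclic-symmetric tensor satisfy \<open>\<Sum>k. x $ k * Q k x = 0\<close>. At a base point
  x, both the left and the right kernel of the Weddle matrix therefore contain x, and its determinant
  vanishes there to second order.

  For one explicit tensor each \<open>Q k\<close> is a product of two linear forms, and its base points are
  the walks with steps \<open>(a, b) \<mapsto> (b, a)\<close> and \<open>(a, b) \<mapsto> (b, - a - b)\<close> from
  \<open>(0, 1)\<close> that end with the coordinate 0. They are counted by the Jacobsthal recursion, and
  the Jacobian has corank one at each of them. By elimination some polynomial g does not vanish
  at this tensor, and \<open>g T \<noteq> 0\<close> implies that all base points of T lie in one affine chart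
  and are nondegenerate. By the inverse function theorem and compactness the number of base points
  is locally constant on \<open>{g \<noteq> 0}\<close>. It is constant there because any two points of this set
  lie on a complex line, of which only finitely many points are missing.
\<close>

section \<open>Cyclic-symmetric tensors and the Weddle locus\<close>

text \<open>The relation among the quadrics makes them a section of the cotangent bundle of P(V)
  twisted by 3, whose top Chern number is (2^n - (-1)^n)/3, the Jacobsthal number. A count at one
  tensor followed by continuation stands in for this intersection number. Two obstacles shape the
  argument. The Jacobian of the quadrics is singular at every base point, so the inverse function
  theorem does not apply to them directly. Adding x_a - 1 to the equation of index a repairs this:
  by the same relation, a solution of the new system satisfies x_a (x_a - 1) = 0, so no solution
  with x_a nonzero is added. The homogeneous version of its derivative is
  \<open>augmented_jacobian\<close>. Moreover, nondegeneracy must hold on a Zariski open set and not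
  only near the explicit tensor. This calls for an algebraic certificate at that tensor, and the
  certificate can be built by hand because all its quadrics split into linear factors.\<close>

definition quadric_jacobian :: "('n::finite) tensor3 \<Rightarrow> complex ^ 'n \<Rightarrow> complex ^ 'n ^ 'n" where
  "quadric_jacobian T x = (\<chi> k i. 2 * (\<Sum>j\<in>UNIV. T $ (i, j, k) * x $ j))"

lemma quadric_eq: "quadric T k x = (\<Sum>i\<in>UNIV. \<Sum>j\<in>UNIV. T $ (i, j, k) * x $ i * x $ j)"
  by (simp add: quadric_def face_def)

lemma quadric_scale: "quadric T k (c *s x) = c\<^sup>2 * quadric T k x"
  by (simp add: quadric_eq sum_distrib_left power2_eq_square algebra_simps)

lemma quadric_jacobian_scale: "quadric_jacobian T (c *s x) $ k $ i = c * quadric_jacobian T x $ k $ i"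
  by (simp add: quadric_jacobian_def sum_distrib_left algebra_simps)

lemma quadric_jacobian_add: "quadric_jacobian T (x + y) = quadric_jacobian T x + quadric_jacobian T y"
  by (simp add: quadric_jacobian_def vec_eq_iff sum_distrib_left algebra_simps sum.distrib)

lemma quadric_jacobian_mult_self: "(quadric_jacobian T x *v x) $ k = 2 * quadric T k x"
  by (simp add: quadric_eq quadric_jacobian_def matrix_vector_mult_def sum_distrib_left sum_distrib_right
      mult_ac)

lemma cyclic_symmetric_tensorsD:
  assumes "T \<in> cyclic_symmetric_tensors"
  shows "T $ (i, j, k) + T $ (j, k, i) + T $ (k, i, j) = 0" "T $ (i, j, k) = T $ (j, i, k)"
  using assms unfolding cyclic_symmetric_tensors_def by blast+

lemma quadric_jacobian_mult:
  assumes "T \<in> cyclic_symmetric_tensors"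
  shows "(quadric_jacobian T x *v y) $ k
    = (\<Sum>i\<in>UNIV. \<Sum>j\<in>UNIV. T $ (i, j, k) * (x $ i * y $ j + y $ i * x $ j))"
proof -
  have "(\<Sum>i\<in>UNIV. \<Sum>j\<in>UNIV. T $ (i, j, k) * x $ i * y $ j)
      = (\<Sum>i\<in>UNIV. \<Sum>j\<in>UNIV. T $ (i, j, k) * y $ i * x $ j)"
    by (subst sum.swap, intro sum.cong refl, subst cyclic_symmetric_tensorsD(2)[OF assms])
      (simp add: mult_ac)
  moreover have "(quadric_jacobian T x *v y) $ k
      = 2 * (\<Sum>i\<in>UNIV. \<Sum>j\<in>UNIV. T $ (i, j, k) * y $ i * x $ j)"
    by (simp add: quadric_jacobian_def matrix_vector_mult_def sum_distrib_left sum_distrib_right mult_ac)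
  ultimately show ?thesis
    by (simp add: distrib_left sum.distrib mult.assoc)
qed

lemma quadric_add:
  assumes "T \<in> cyclic_symmetric_tensors"
  shows "quadric T k (x + y) = quadric T k x + (quadric_jacobian T x *v y) $ k + quadric T k y"
  by (simp add: quadric_jacobian_mult[OF assms] quadric_eq distrib_left distrib_right sum.distrib add_ac mult.assoc)

text \<open>Symmetrizing in \<open>j\<close> and \<open>k\<close> turns twice the contraction into
  two of the three cyclic terms; the cyclic equation replaces them by minus the third, which is the
  quadric.\<close>

lemma cyclic_contraction:
  assumes "T \<in> cyclic_symmetric_tensors"
  shows "(\<Sum>j\<in>UNIV. \<Sum>k\<in>UNIV. 2 * T $ (i, j, k) * x $ j * x $ k) = - quadric T i x"
proof -
  have "(\<Sum>j\<in>UNIV. \<Sum>k\<in>UNIV. T $ (i, j, k) * x $ j * x $ k)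
      = (\<Sum>j\<in>UNIV. \<Sum>k\<in>UNIV. T $ (i, k, j) * x $ j * x $ k)"
    by (subst sum.swap) (simp add: algebra_simps)
  then have "(\<Sum>j\<in>UNIV. \<Sum>k\<in>UNIV. 2 * T $ (i, j, k) * x $ j * x $ k)
      = (\<Sum>j\<in>UNIV. \<Sum>k\<in>UNIV. (T $ (i, j, k) + T $ (k, i, j)) * x $ j * x $ k)"
    using cyclic_symmetric_tensorsD(2)[OF assms]
    by (simp add: distrib_right sum.distrib flip: mult_2 sum_distrib_left)
      (simp add: mult.assoc flip: sum_distrib_left)
  also have "\<dots> = (\<Sum>j\<in>UNIV. \<Sum>k\<in>UNIV. - (T $ (j, k, i) * x $ j * x $ k))"
  proof (intro sum.cong refl)
    fix j k
    have "T $ (i, j, k) + T $ (k, i, j) = - T $ (j, k, i)"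
      using cyclic_symmetric_tensorsD(1)[OF assms, of i j k]
      by (simp add: eq_neg_iff_add_eq_0 add_ac)
    then show "(T $ (i, j, k) + T $ (k, i, j)) * x $ j * x $ k = - (T $ (j, k, i) * x $ j * x $ k)"
      by simp
  qed
  finally show ?thesis by (simp add: quadric_eq sum_negf)
qed

lemma vector_mult_quadric_jacobian:
  assumes "T \<in> cyclic_symmetric_tensors"
  shows "(x v* quadric_jacobian T x) $ i = - quadric T i x"
proof -
  have "(x v* quadric_jacobian T x) $ i = (\<Sum>k\<in>UNIV. \<Sum>j\<in>UNIV. 2 * T $ (i, j, k) * x $ j * x $ k)"
    by (simp add: vector_matrix_mult_def quadric_jacobian_def sum_distrib_left mult_ac)
  then show ?thesis
    using cyclic_contraction[OF assms, of i x] by (subst (asm) sum.swap) simp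
qed

lemma quadric_line:
  assumes "T \<in> cyclic_symmetric_tensors"
  shows "quadric T k (x + c *s y)
    = quadric T k x + c * (quadric_jacobian T x *v y) $ k + c\<^sup>2 * quadric T k y"
  by (simp add: quadric_add[OF assms] quadric_scale vector_scalar_commute)

lemma coordinate_line:
  fixes x :: "complex ^ 'n"
  shows "(\<chi> j. if j = i then t else x $ j) = x + (t - x $ i) *s axis i 1"
  by (auto simp: vec_eq_iff axis_def)

lemma matrix_mult_axis: "((A :: complex ^ 'n ^ 'n) *v axis i 1) $ k = A $ k $ i"
  by (simp add: matrix_vector_mult_def axis_def if_distrib[of "(*) _"] cong: if_cong)

text \<open>The hypothesis supplies the symmetry in the first two slots, without which
  \<open>quadric_jacobian\<close> need not be the Jacobian. Its formula is linear in
  \<open>T\<close> for arbitrary tensors, which suits elimination over the full tensor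
  space.\<close>

lemma partial_deriv_quadric:
  assumes "T \<in> cyclic_symmetric_tensors"
  shows "partial_deriv i (quadric T k) x = quadric_jacobian T x $ k $ i"
proof -
  have "((\<lambda>t. quadric T k x + (t - x $ i) * (quadric_jacobian T x *v axis i 1) $ k
      + (t - x $ i)\<^sup>2 * quadric T k (axis i 1)) has_field_derivative
      (quadric_jacobian T x *v axis i 1) $ k) (at (x $ i))"
    by (auto intro!: derivative_eq_intros)
  then show ?thesis
    unfolding partial_deriv_def coordinate_line quadric_line[OF assms]
    by (simp add: DERIV_imp_deriv matrix_mult_axis)
qed

lemma weddle_matrix_quadric:
  assumes "T \<in> cyclic_symmetric_tensors"
  shows "weddle_matrix (quadric T) x = transpose (quadric_jacobian T x)"
  by (simp add: weddle_matrix_def transpose_def partial_deriv_quadric[OF assms])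

section \<open>Homogeneous coordinates and the affine chart x_a = 1\<close>

lemma vanishes_at_span:
  assumes "\<And>c x. f x = 0 \<Longrightarrow> f (c *s x) = 0" "x \<noteq> 0"
  shows "vanishes_at f (vec.span {x}) \<longleftrightarrow> f x = 0"
proof
  assume "vanishes_at f (vec.span {x})"
  then show "f x = 0" using assms(2) vec.span_base[of x "{x}"] by (simp add: vanishes_at_def)
qed (use assms(1) in \<open>auto simp: vanishes_at_def vec.span_singleton\<close>)

lemma proj_space_iff: "P \<in> proj_space \<longleftrightarrow> (\<exists>x. x \<noteq> 0 \<and> P = vec.span {x})"
proof
  assume "P \<in> proj_space"
  then have P: "vec.subspace P" "vec.dim P = 1"
    by (auto simp: proj_space_def)
  obtain B where B: "B \<subseteq> P" "vec.independent B" "P \<subseteq> vec.span B" "card B = vec.dim P"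
    using vec.basis_exists by blast
  then obtain x where "B = {x}"
    using P(2) card_1_singletonE by metis
  moreover have "vec.span B = P"
    using B P by (metis vec.span_subspace)
  ultimately show "\<exists>x. x \<noteq> 0 \<and> P = vec.span {x}"
    using B(2) vec.dependent_zero by auto
next
  assume "\<exists>x. x \<noteq> 0 \<and> P = vec.span {x}"
  then show "P \<in> proj_space"
    by (auto simp: proj_space_def vec.dim_singleton)
qed

lemma base_points_iff:
  "P \<in> base_points (quadric T) \<longleftrightarrow>
    (\<exists>x. x \<noteq> 0 \<and> P = vec.span {x} \<and> (\<forall>k. quadric T k x = 0))"
  by (auto simp: base_points_def proj_space_iff vanishes_at_span quadric_scale)

definition chart_zeros :: "'n::finite \<Rightarrow> 'n tensor3 \<Rightarrow> (complex ^ 'n) set" where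
  "chart_zeros a T = {x. x $ a = 1 \<and> (\<forall>k. quadric T k x = 0)}"

lemma bij_betw_chart_zeros_base_points:
  assumes "\<And>x. x \<noteq> 0 \<Longrightarrow> \<forall>k. quadric T k x = 0 \<Longrightarrow> x $ a \<noteq> 0"
  shows "bij_betw (\<lambda>x. vec.span {x}) (chart_zeros a T) (base_points (quadric T))"
  unfolding bij_betw_def
proof
  show "inj_on (\<lambda>x. vec.span {x}) (chart_zeros a T)"
  proof (rule inj_onI)
    fix x y assume xy: "x \<in> chart_zeros a T" "y \<in> chart_zeros a T" "vec.span {x} = vec.span {y}"
    then obtain c where "y = c *s x"
      using vec.span_base[of y "{y}"] by (auto simp: vec.span_singleton)
    then show "x = y" using xy by (auto simp: chart_zeros_def)
  qed
  show "(\<lambda>x. vec.span {x}) ` chart_zeros a T = base_points (quadric T)"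
  proof (intro equalityI subsetI)
    fix P assume "P \<in> (\<lambda>x. vec.span {x}) ` chart_zeros a T"
    then obtain x where "P = vec.span {x}" "x $ a = 1" "\<forall>k. quadric T k x = 0"
      by (auto simp: chart_zeros_def)
    moreover from this have "x \<noteq> 0" by auto
    ultimately show "P \<in> base_points (quadric T)"
      unfolding base_points_iff by blast
  next
    fix P assume "P \<in> base_points (quadric T)"
    then obtain x where x: "x \<noteq> 0" "P = vec.span {x}" "\<forall>k. quadric T k x = 0"
      by (auto simp: base_points_iff)
    define y where "y = inverse (x $ a) *s x"
    have xo: "x $ a \<noteq> 0" using assms x by blast
    have "vec.span {x} = vec.span {y}"
    proof -
      have "x = (x $ a) *s y" using xo by (simp add: y_def vec.scale_scale)
      then have "x \<in> vec.span {y}" by (auto simp: vec.span_singleton)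
      moreover have "y \<in> vec.span {x}" by (auto simp: vec.span_singleton y_def)
      ultimately show ?thesis by (simp add: vec.span_eq)
    qed
    moreover have "y \<in> chart_zeros a T"
      using x xo by (simp add: chart_zeros_def y_def quadric_scale)
    ultimately show "P \<in> (\<lambda>x. vec.span {x}) ` chart_zeros a T" using x by blast
  qed
qed


text \<open>Cramer's lemma, applied to a column and then to a row, multiplies the determinant by
  \<open>x $ a\<close> twice and makes column \<open>a\<close> and row \<open>a\<close> multiples of
  t. Their common entry is t times the quadratic form of \<open>B\<close> at \<open>x\<close>; only
  because this vanishes can t be extracted from both.\<close>

lemma det_double_zero:
  fixes A B :: "complex ^ 'n ^ 'n"
  assumes "x \<noteq> 0" "x v* A = 0" "A *v x = 0" "(\<Sum>i\<in>UNIV. \<Sum>j\<in>UNIV. x $ i * B $ i $ j * x $ j) = 0"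
  shows "\<exists>h. isCont h 0 \<and> (\<forall>t. det (\<chi> i j. A $ i $ j + t * B $ i $ j) = t\<^sup>2 * h t)"
proof -
  obtain a where a: "x $ a \<noteq> 0"
    using assms(1) by (auto simp: vec_eq_iff)
  define M where "M t = (\<chi> i j. A $ i $ j + t * B $ i $ j)" for t
  \<comment> \<open>What remains after a factor t is removed from row \<open>a\<close> and from
    column \<open>a\<close>.\<close>
  define N where "N t = (\<chi> i j. if i = a then (if j = a then 0 else (x v* B) $ j)
      else if j = a then (B *v x) $ i else M t $ i $ j)" for t
  have Mx: "M t *v x = t *s (B *v x)" for t
  proof -
    have "M t *v x = A *v x + t *s (B *v x)"
      by (simp add: M_def vec_eq_iff matrix_vector_mult_def sum.distrib sum_distrib_left algebra_simps)
    then show ?thesis using assms by simp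
  qed
  have xM: "x v* M t = t *s (x v* B)" for t
  proof -
    have "x v* M t = x v* A + t *s (x v* B)"
      by (simp add: M_def vec_eq_iff vector_matrix_mult_def sum.distrib sum_distrib_left algebra_simps)
    then show ?thesis using assms by simp
  qed
  have xBx: "(\<Sum>i\<in>UNIV. (B *v x) $ i * x $ i) = 0"
    using assms(4) by (simp add: matrix_vector_mult_def sum_distrib_left sum_distrib_right mult_ac)
  have "(x $ a)\<^sup>2 * det (M t) = t\<^sup>2 * det (N t)" for t
  proof -
    define C where "C = (\<chi> i j. if j = a then t * (B *v x) $ i else M t $ i $ j)"
    have "x $ a * det (M t) = det C"
      using cramer_lemma[of a "M t" x] by (simp add: Mx C_def cong: if_cong)
    moreover have "x $ a * det C = det (\<chi> i j. if i = a then (if j = a then 0 else t * (x v* B) $ j)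
        else C $ i $ j)"
    proof -
      have xC: "(x v* C) $ j = (if j = a then 0 else t * (x v* B) $ j)" for j
      proof (cases "j = a")
        case True
        moreover have "(\<Sum>i\<in>UNIV. x $ i * (t * (B *v x) $ i)) = t * (\<Sum>i\<in>UNIV. (B *v x) $ i * x $ i)"
          by (simp add: sum_distrib_left mult_ac)
        ultimately show ?thesis using xBx
          by (simp add: C_def vector_matrix_mult_def)
      next
        case False
        then have "(x v* C) $ j = (x v* M t) $ j"
          by (simp add: C_def vector_matrix_mult_def)
        then show ?thesis using False by (simp add: xM)
      qed
      have "x $ a * det C = det (transpose (\<chi> i j. if j = a then (transpose C *v x) $ i
          else transpose C $ i $ j))"
        using cramer_lemma[of a "transpose C" x] by (simp add: det_transpose)
      also have "transpose (\<chi> i j. if j = a then (transpose C *v x) $ i else transpose C $ i $ j)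
        = (\<chi> i j. if i = a then (if j = a then 0 else t * (x v* B) $ j) else C $ i $ j)"
        using xC by (simp add: transpose_def vec_eq_iff matrix_vector_mult_def
            vector_matrix_mult_def mult.commute)
      finally show ?thesis .
    qed
    moreover have "det (\<chi> i j. if i = a then (if j = a then 0 else t * (x v* B) $ j)
        else C $ i $ j) = t * (t * det (N t))"
    proof -
      define D where "D = (\<chi> i j. if i = a then (if j = a then 0 else (x v* B) $ j)
        else C $ i $ j)"
      have "(\<chi> i j. if i = a then (if j = a then 0 else t * (x v* B) $ j) else C $ i $ j)
          = (\<chi> i. if i = a then t *s D $ i else D $ i)"
        by (auto simp: D_def vec_eq_iff)
      moreover have "(\<chi> i. if i = a then D $ i else D $ i) = D" by (simp add: vec_eq_iff)
      ultimately have "det (\<chi> i j. if i = a then (if j = a then 0 else t * (x v* B) $ j)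
        else C $ i $ j) = t * det D"
        using det_row_mul[of a t "($) D" "($) D"] by simp
      have "transpose D = (\<chi> i. if i = a then t *s transpose (N t) $ i else transpose (N t) $ i)"
        by (auto simp: D_def C_def N_def vec_eq_iff transpose_def)
      moreover have "(\<chi> i. if i = a then transpose (N t) $ i else transpose (N t) $ i)
          = transpose (N t)" by (simp add: vec_eq_iff)
      ultimately have "det (transpose D) = t * det (transpose (N t))"
        using det_row_mul[of a t "($) (transpose (N t))" "($) (transpose (N t))"] by simp
      then show ?thesis
        using \<open>det _ = t * det D\<close> by (simp add: det_transpose)
    qed
    ultimately show ?thesis by (simp add: power2_eq_square mult.assoc)
  qed
  then have "det (M t) = t\<^sup>2 * (det (N t) / (x $ a)\<^sup>2)" for t
    using a by (simp add: field_simps)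
  moreover have "isCont (\<lambda>t. det (N t) / (x $ a)\<^sup>2) 0"
  proof -
    have "isCont (\<lambda>t. N t $ i $ j) 0" for i j
      by (cases "i = a"; cases "j = a") (simp_all add: N_def M_def)
    then show ?thesis
      unfolding det_def using a
      by (intro continuous_divide continuous_sum continuous_mult continuous_prod continuous_const) auto
  qed
  ultimately show ?thesis unfolding M_def by blast
qed

lemma base_points_subset_weddle_singular_points:
  assumes T: "T \<in> cyclic_symmetric_tensors"
  shows "base_points (quadric T) \<subseteq> weddle_singular_points (quadric T)"
proof
  fix P assume P: "P \<in> base_points (quadric T)"
  have "det (weddle_matrix (quadric T) x) = 0
      \<and> partial_deriv i (\<lambda>x. det (weddle_matrix (quadric T) x)) x = 0"
    if x: "x \<in> P" "x \<noteq> 0" for x i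
  proof -
    have Q: "quadric T k x = 0" for k
      using P x by (auto simp: base_points_def vanishes_at_def)
    define A where "A = quadric_jacobian T x"
    define B where "B = quadric_jacobian T (axis i 1)"
    have "A *v x = 0" "x v* A = 0"
      by (simp_all add: A_def vec_eq_iff quadric_jacobian_mult_self vector_mult_quadric_jacobian[OF T] Q)
    \<comment> \<open>Cyclic symmetry enters again: this double contraction equals
      \<open>- quadric T i x\<close>.\<close>
    moreover have "(\<Sum>k\<in>UNIV. \<Sum>j\<in>UNIV. x $ k * B $ k $ j * x $ j) = 0"
    proof -
      have "B $ k $ j = 2 * T $ (i, j, k)" for k j
        using cyclic_symmetric_tensorsD(2)[OF T, of i j k]
        by (simp add: B_def quadric_jacobian_def axis_def if_distrib[of "(*) _"] cong: if_cong)
      then show ?thesis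
        using cyclic_contraction[OF T, of i x] Q[of i]
        by (subst sum.swap) (simp add: mult_ac)
    qed
    ultimately obtain h where h: "isCont h 0"
      "\<And>t. det (\<chi> k j. A $ k $ j + t * B $ k $ j) = t\<^sup>2 * h t"
      using det_double_zero[OF x(2), of A B] by auto
    have W: "weddle_matrix (quadric T) (x + t *s axis i 1)
        = transpose (\<chi> k j. A $ k $ j + t * B $ k $ j)" for t
      by (simp add: weddle_matrix_quadric[OF T] A_def B_def quadric_jacobian_add quadric_jacobian_scale
          vec_eq_iff transpose_def)
    have D: "det (weddle_matrix (quadric T) (x + t *s axis i 1)) = t\<^sup>2 * h t" for t
      by (simp add: W det_transpose h)
    \<comment> \<open>Continuity of \<open>h\<close> at 0 suffices, since the difference quotient at
      0 is t h(t).\<close>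
    have "((\<lambda>t. t\<^sup>2 * h t) has_field_derivative 0) (at 0)"
    proof -
      have "((\<lambda>t. t * h t) \<longlongrightarrow> 0 * h 0) (at 0)"
        using h(1) by (intro tendsto_intros) (simp add: isCont_def)
      then show ?thesis
        unfolding DERIV_def
        by (auto elim!: Lim_transform_eventually simp: eventually_at_filter power2_eq_square)
    qed
    then have "((\<lambda>t. (t - x $ i)\<^sup>2 * h (t - x $ i)) has_field_derivative 0) (at (x $ i))"
      using DERIV_shift[of "\<lambda>t. (t - x $ i)\<^sup>2 * h (t - x $ i)" 0 0 "x $ i"] by simp
    then have "partial_deriv i (\<lambda>x. det (weddle_matrix (quadric T) x)) x = 0"
      unfolding partial_deriv_def coordinate_line D by (rule DERIV_imp_deriv)
    moreover have "det (weddle_matrix (quadric T) x) = 0"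
      using D[of 0] by simp
    ultimately show ?thesis by simp
  qed
  then show "P \<in> weddle_singular_points (quadric T)"
    using P by (auto simp: weddle_singular_points_def weddle_locus_def vanishes_at_def base_points_def)
qed

section \<open>Elimination\<close>

lemma complex_poly_fun_diff:
  assumes "complex_poly_fun f" "complex_poly_fun g"
  shows "complex_poly_fun (\<lambda>x. f x - g x)"
  using complex_poly_fun.add[OF assms(1) complex_poly_fun.mult[OF complex_poly_fun.const[of "-1"] assms(2)]]
  by simp

lemma complex_poly_fun_line:
  assumes "complex_poly_fun f"
  shows "\<exists>p. \<forall>s. f (A + s *s B) = poly p s"
  using assms
proof induction
  case (const c)
  show ?case by (rule exI[of _ "[:c:]"]) simp
next
  case (coord i)
  show ?case by (rule exI[of _ "[:A $ i, B $ i:]"]) simp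
next
  case (add f g)
  then show ?case by (metis poly_add)
next
  case (mult f g)
  then show ?case by (metis poly_mult)
qed

section \<open>Forms in x with coefficients polynomial in the tensor\<close>

inductive form_family :: "nat \<Rightarrow> (complex ^ 'm \<Rightarrow> complex ^ 'n \<Rightarrow> complex) \<Rightarrow> bool" where
  coeff: "complex_poly_fun c \<Longrightarrow> form_family 0 (\<lambda>T x. c T)"
| coord: "form_family 1 (\<lambda>T x. x $ i)"
| add: "form_family d F \<Longrightarrow> form_family d G \<Longrightarrow> form_family d (\<lambda>T x. F T x + G T x)"
| mult: "form_family d F \<Longrightarrow> form_family e G \<Longrightarrow> form_family (d + e) (\<lambda>T x. F T x * G T x)"

inductive form :: "nat \<Rightarrow> (complex ^ 'n \<Rightarrow> complex) \<Rightarrow> bool" where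
  const: "form 0 (\<lambda>x. c)"
| coord: "form 1 (\<lambda>x. x $ i)"
| add: "form d f \<Longrightarrow> form d g \<Longrightarrow> form d (\<lambda>x. f x + g x)"
| mult: "form d f \<Longrightarrow> form e g \<Longrightarrow> form (d + e) (\<lambda>x. f x * g x)"

lemma form_family_at: "form_family d F \<Longrightarrow> form d (F T)"
  by (induction rule: form_family.induct) (auto intro: form.intros[unfolded One_nat_def])

lemma form_family_const: "form d f \<Longrightarrow> form_family d (\<lambda>T. f)"
  by (induction rule: form.induct)
    (auto intro: form_family.intros[unfolded One_nat_def] complex_poly_fun.const)

lemma form_family_zero: "form_family d (\<lambda>T x. 0)"
proof (induction d)
  case 0
  show ?case by (intro form_family.coeff complex_poly_fun.const)
next
  case (Suc d)
  show ?case using form_family.mult[OF form_family.coord Suc] by simp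
qed

lemma form_family_scale:
  assumes "complex_poly_fun c" "form_family d F"
  shows "form_family d (\<lambda>T x. c T * F T x)"
  using form_family.mult[OF form_family.coeff[OF assms(1)] assms(2)] by simp

lemma form_family_sum:
  assumes "\<And>i. i \<in> I \<Longrightarrow> form_family d (F i)"
  shows "form_family d (\<lambda>T x. \<Sum>i\<in>I. F i T x)"
  using assms by (induction I rule: infinite_finite_induct)
    (auto intro: form_family.add form_family_zero)

lemma form_family_prod:
  assumes "finite I" "\<And>i. i \<in> I \<Longrightarrow> form_family 1 (F i)"
  shows "form_family (card I) (\<lambda>T x. \<Prod>i\<in>I. F i T x)"
  using assms
proof (induction I rule: finite_induct)
  case empty
  show ?case using form_family.coeff[OF complex_poly_fun.const[of 1]] by simp
next
  case (insert i I)
  then show ?case using form_family.mult[of 1 "F i" "card I"] by simp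
qed

lemma form_family_det:
  fixes A :: "complex ^ 'm \<Rightarrow> complex ^ 'n \<Rightarrow> complex ^ 'n ^ 'n"
  assumes "\<And>i j. form_family 1 (\<lambda>T x. A T x $ i $ j)"
  shows "form_family CARD('n) (\<lambda>T x. det (A T x))"
  unfolding det_def
  by (intro form_family_sum form_family_scale[OF complex_poly_fun.const] form_family_prod finite assms)

text \<open>Words are ordered, so one monomial has many words. Products become concatenations,
  undone by \<open>take\<close> and \<open>drop\<close>; the coefficients are not unique, but only
  the existence of an expansion is used.\<close>

definition monomial :: "'n list \<Rightarrow> complex ^ 'n \<Rightarrow> complex" where
  "monomial w x = (\<Prod>i\<leftarrow>w. x $ i)"

lemma monomial_append: "monomial (v @ w) x = monomial v x * monomial w x"
  by (simp add: monomial_def)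

lemma finite_words: "finite {w :: 'n::finite list. length w = d}"
  using finite_lists_length_eq[of "UNIV :: 'n set" d] by simp

lemma sum_words_mult:
  fixes f g :: "'n::finite list \<Rightarrow> complex"
  shows "(\<Sum>w | length w = d. f w) * (\<Sum>w | length w = e. g w)
    = (\<Sum>w | length w = d + e. f (take d w) * g (drop d w))"
  unfolding sum_product sum.cartesian_product
  by (rule sum.reindex_bij_witness[where i = "\<lambda>w. (take d w, drop d w)" and j = "\<lambda>(v, w). v @ w"])
    auto

lemma form_family_expand:
  fixes F :: "complex ^ 'm \<Rightarrow> complex ^ 'n::finite \<Rightarrow> complex"
  assumes "form_family d F"
  shows "\<exists>c. (\<forall>w. complex_poly_fun (c w)) \<and>
    (\<forall>T x. F T x = (\<Sum>w | length w = d. c w T * monomial w x))"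
  using assms
proof induction
  case (coeff c)
  then show ?case by (intro exI[of _ "\<lambda>w. c"]) (simp add: monomial_def)
next
  case (coord i)
  have "(\<Sum>w | length w = 1. (if w = [i] then 1 else 0) * monomial w x)
      = (\<Sum>w\<in>{[i]}. (if w = [i] then 1 else 0) * monomial w x)" for x :: "complex ^ 'n"
    by (rule sum.mono_neutral_right) (auto simp: finite_words)
  then have *: "x $ i = (\<Sum>w | length w = 1. (if w = [i] then 1 else 0) * monomial w x)"
    for x :: "complex ^ 'n" by (simp add: monomial_def)
  show ?case
    by (rule exI[of _ "\<lambda>w T. if w = [i] then 1 else 0"])
      (intro conjI allI complex_poly_fun.const *)
next
  case (add d F G)
  from add.IH(1) obtain a where "\<forall>w. complex_poly_fun (a w)"
    "\<forall>T x. F T x = (\<Sum>w | length w = d. a w T * monomial w x)" by blast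
  moreover from add.IH(2) obtain b where "\<forall>w. complex_poly_fun (b w)"
    "\<forall>T x. G T x = (\<Sum>w | length w = d. b w T * monomial w x)" by blast
  ultimately show ?case
    by (intro exI[of _ "\<lambda>w T. a w T + b w T"])
      (simp add: complex_poly_fun.add sum.distrib distrib_right)
next
  case (mult d F e G)
  from mult.IH(1) obtain a where a: "\<forall>w. complex_poly_fun (a w)"
    "\<forall>T x. F T x = (\<Sum>w | length w = d. a w T * monomial w x)" by blast
  from mult.IH(2) obtain b where b: "\<forall>w. complex_poly_fun (b w)"
    "\<forall>T x. G T x = (\<Sum>w | length w = e. b w T * monomial w x)" by blast
  have m: "monomial w x = monomial (take d w) x * monomial (drop d w) x" for w and x :: "complex ^ 'n"
    by (metis append_take_drop_id monomial_append)
  have "F T x * G T x = (\<Sum>w | length w = d + e. a (take d w) T * b (drop d w) T * monomial w x)"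
    for T x
  proof -
    have "F T x * G T x = (\<Sum>w | length w = d + e. (a (take d w) T * monomial (take d w) x)
        * (b (drop d w) T * monomial (drop d w) x))"
      unfolding a(2)[rule_format] b(2)[rule_format] by (rule sum_words_mult)
    also have "\<dots> = (\<Sum>w | length w = d + e. a (take d w) T * b (drop d w) T * monomial w x)"
      by (intro sum.cong refl) (subst (3) m, simp)
    finally show ?thesis .
  qed
  then show ?case using a(1) b(1)
    by (intro exI[of _ "\<lambda>w T. a (take d w) T * b (drop d w) T"]) (simp add: complex_poly_fun.mult)
qed

text \<open>Fraction-free Gaussian elimination: g is the product of the successive pivots, each of
  which is 1 at \<open>T0\<close>. Indexing by a finite set allows the words of a fixed length as
  indices.\<close>

lemma linear_system_near_identity:
  fixes M :: "'b \<Rightarrow> 'b \<Rightarrow> complex ^ 'm \<Rightarrow> complex"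
  assumes "finite S"
    and "\<And>a b. a \<in> S \<Longrightarrow> b \<in> S \<Longrightarrow> complex_poly_fun (M a b)"
    and "\<And>a b. a \<in> S \<Longrightarrow> b \<in> S \<Longrightarrow> M a b T0 = of_bool (a = b)"
  shows "\<exists>g. complex_poly_fun g \<and> g T0 = 1 \<and>
    (\<forall>T y. g T \<noteq> 0 \<longrightarrow> (\<forall>a\<in>S. (\<Sum>b\<in>S. M a b T * y b) = 0) \<longrightarrow> (\<forall>b\<in>S. y b = 0))"
  using assms
proof (induction S arbitrary: M rule: finite_induct)
  case empty
  show ?case by (intro exI[of _ "\<lambda>T. 1"]) (auto intro: complex_poly_fun.const)
next
  case (insert c S)
  \<comment> \<open>Cross-multiplication with the pivot row eliminates the unknown
    \<open>y c\<close> and keeps the entries polynomial.\<close>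
  define N where "N a b T = M c c T * M a b T - M a c T * M c b T" for a b T
  have poly: "complex_poly_fun (M a b)" if "a \<in> insert c S" "b \<in> insert c S" for a b
    using insert.prems(1) that by blast
  have "complex_poly_fun (N a b)" if "a \<in> S" "b \<in> S" for a b
    unfolding N_def[abs_def] using that
    by (intro complex_poly_fun_diff complex_poly_fun.mult poly) auto
  moreover have "N a b T0 = of_bool (a = b)" if "a \<in> S" "b \<in> S" for a b
    using that insert.hyps insert.prems(2) by (auto simp: N_def)
  ultimately obtain g where g: "complex_poly_fun g" "g T0 = 1"
    "\<And>T y. g T \<noteq> 0 \<Longrightarrow> \<forall>a\<in>S. (\<Sum>b\<in>S. N a b T * y b) = 0 \<Longrightarrow> \<forall>b\<in>S. y b = 0"
    using insert.IH[of N] by blast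
  show ?case
  proof (intro exI[of _ "\<lambda>T. g T * M c c T"] conjI allI impI)
    show "complex_poly_fun (\<lambda>T. g T * M c c T)"
      by (intro complex_poly_fun.mult g poly) auto
    show "g T0 * M c c T0 = 1"
      using g insert.prems(2) by simp
  next
    fix T y assume T: "g T * M c c T \<noteq> 0" and "\<forall>a\<in>insert c S. (\<Sum>b\<in>insert c S. M a b T * y b) = 0"
    then have eq: "M a c T * y c = - (\<Sum>b\<in>S. M a b T * y b)" if "a \<in> insert c S" for a
      using that insert.hyps by (auto simp: add_eq_0_iff2)
    have "(\<Sum>b\<in>S. N a b T * y b) = 0" if "a \<in> S" for a
    proof -
      have "(\<Sum>b\<in>S. N a b T * y b)
          = M c c T * (\<Sum>b\<in>S. M a b T * y b) - M a c T * (\<Sum>b\<in>S. M c b T * y b)"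
        by (simp add: N_def sum_distrib_left sum_subtractf algebra_simps)
      also have "\<dots> = M c c T * (- (M a c T * y c)) - M a c T * (- (M c c T * y c))"
        using eq[of a] eq[of c] that by simp
      finally show ?thesis by simp
    qed
    then have y: "\<forall>b\<in>S. y b = 0" using g(3)[of T y] T by simp
    then have "y c = 0" using eq[of c] T by simp
    then show "\<forall>b\<in>insert c S. y b = 0" using y by simp
  qed
qed

section \<open>Ideals with tracked degrees and their deformation\<close>

inductive graded_ideal :: "(nat \<times> (complex ^ 'n \<Rightarrow> complex)) set \<Rightarrow> nat \<Rightarrow> (complex ^ 'n \<Rightarrow> complex) \<Rightarrow> bool"
  for G where
  zero: "graded_ideal G d (\<lambda>x. 0)"
| gen: "(d, f) \<in> G \<Longrightarrow> graded_ideal G d f"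
| add: "graded_ideal G d f \<Longrightarrow> graded_ideal G d g \<Longrightarrow> graded_ideal G d (\<lambda>x. f x + g x)"
| mult: "form d h \<Longrightarrow> graded_ideal G e f \<Longrightarrow> graded_ideal G (d + e) (\<lambda>x. h x * f x)"

text \<open>The elements that \<open>a\<close> multiplies into the ideal of \<open>H\<close> are
  closed under sums and multiples by forms, so a test on generators suffices.\<close>

lemma graded_ideal_colon:
  assumes "graded_ideal G e b"
    and "\<And>e v. (e, v) \<in> G \<Longrightarrow> graded_ideal H (d + e) (\<lambda>x. a x * v x)"
  shows "graded_ideal H (d + e) (\<lambda>x. a x * b x)"
  using assms(1)
proof induction
  case (zero e)
  then show ?case using graded_ideal.zero by simp
next
  case (gen e f)
  then show ?case using assms(2) by simp
next
  case (add e f g)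
  then show ?case using graded_ideal.add[OF add.IH] by (simp add: distrib_left)
next
  case (mult k h e f)
  then show ?case using graded_ideal.mult[OF mult.hyps(1) mult.IH]
    by (simp add: add.left_commute mult.left_commute)
qed

text \<open>In ideal notation, (I + u)(I + v) lies in I as soon as uv does. Two colon arguments: v a
  lies in I because v u does, and then a b lies in I because a v does.\<close>

lemma graded_ideal_mult_split:
  assumes "graded_ideal (insert (1, u) G) d a" "graded_ideal (insert (1, v) G) e b"
    and "form d a" "form 1 v" "graded_ideal G 2 (\<lambda>x. u x * v x)"
  shows "graded_ideal G (d + e) (\<lambda>x. a x * b x)"
proof (rule graded_ideal_colon[OF assms(2)])
  fix k f assume "(k, f) \<in> insert (1, v) G"
  then consider "k = 1" "f = v" | "(k, f) \<in> G" by auto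
  then show "graded_ideal G (d + k) (\<lambda>x. a x * f x)"
  proof cases
    case 1
    have "graded_ideal G (1 + d) (\<lambda>x. v x * a x)"
    proof (rule graded_ideal_colon[OF assms(1)])
      fix k f assume "(k, f) \<in> insert (1, u) G"
      then show "graded_ideal G (1 + k) (\<lambda>x. v x * f x)"
        using assms(5) graded_ideal.mult[OF assms(4) graded_ideal.gen, of k f G]
        by (auto simp: mult.commute numeral_2_eq_2)
    qed
    then show ?thesis using 1 by (simp add: mult.commute)
  next
    case 2
    then show ?thesis using graded_ideal.mult[OF assms(3) graded_ideal.gen] by blast
  qed
qed

text \<open>The derivation of membership is replayed with every generator replaced by its
  deformation and all multipliers kept. An identity at \<open>T0\<close> alone thus yields an
  equation valid on all of \<open>V\<close>.\<close>

lemma graded_ideal_deform: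
  fixes V :: "complex ^ 'm \<Rightarrow> complex ^ 'n::finite \<Rightarrow> bool"
  assumes "graded_ideal G d f"
    and "\<And>d f. (d, f) \<in> G \<Longrightarrow> \<exists>F. form_family d F \<and> F T0 = f \<and> (\<forall>T x. V T x \<longrightarrow> F T x = 0)"
  shows "\<exists>F. form_family d F \<and> F T0 = f \<and> (\<forall>T x. V T x \<longrightarrow> F T x = 0)"
  using assms(1)
proof induction
  case (zero d)
  show ?case by (intro exI[of _ "\<lambda>T x. 0"]) (simp add: form_family_zero)
next
  case (gen d f)
  then show ?case by (rule assms(2))
next
  case (add d f g)
  then obtain F F' where "form_family d F" "F T0 = f" "\<forall>T x. V T x \<longrightarrow> F T x = 0"
    "form_family d F'" "F' T0 = g" "\<forall>T x. V T x \<longrightarrow> F' T x = 0" by blast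
  then show ?case
    by (intro exI[of _ "\<lambda>T x. F T x + F' T x"]) (auto intro: form_family.add)
next
  case (mult k h e f)
  then obtain F where "form_family e F" "F T0 = f" "\<forall>T x. V T x \<longrightarrow> F T x = 0" by blast
  then show ?case using mult.hyps(1)
    by (intro exI[of _ "\<lambda>T x. h x * F T x"]) (auto intro: form_family.mult form_family_const)
qed

text \<open>
  Elimination: if all words of some degree lie in the ideal of the system at \<open>T0\<close>, the deformed
  words form a square linear system in the words that is the identity at \<open>T0\<close>.
\<close>

lemma elimination:
  fixes V :: "complex ^ 'm \<Rightarrow> complex ^ 'n::finite \<Rightarrow> bool"
  assumes "\<And>w. length w = N \<Longrightarrow> graded_ideal G N (monomial w)"
    and "\<And>d f. (d, f) \<in> G \<Longrightarrow> \<exists>F. form_family d F \<and> F T0 = f \<and> (\<forall>T x. V T x \<longrightarrow> F T x = 0)"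
  shows "\<exists>g. complex_poly_fun g \<and> g T0 \<noteq> 0 \<and> (\<forall>T x. g T \<noteq> 0 \<longrightarrow> V T x \<longrightarrow> x = 0)"
proof -
  let ?W = "{w :: 'n list. length w = N}"
  define P where "P w F c \<longleftrightarrow> F T0 = monomial w \<and> (\<forall>T x. V T x \<longrightarrow> F T x = 0) \<and>
      (\<forall>v. complex_poly_fun (c v)) \<and> (\<forall>T x. F T x = (\<Sum>v\<in>?W. c v T * monomial v x))"
    for w :: "'n list" and F :: "complex ^ 'm \<Rightarrow> complex ^ 'n \<Rightarrow> complex" and c
  have "\<exists>F c. P w F c" if "w \<in> ?W" for w
  proof -
    have "graded_ideal G N (monomial w)" using assms(1) that by simp
    then obtain F where "form_family N F" "F T0 = monomial w" "\<forall>T x. V T x \<longrightarrow> F T x = 0"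
      using graded_ideal_deform[OF _ assms(2)] by blast
    then show ?thesis using form_family_expand[of N F] unfolding P_def by blast
  qed
  then obtain F c where "\<And>w. w \<in> ?W \<Longrightarrow> P w (F w) (c w)"
    by metis
  then have F: "\<And>w. w \<in> ?W \<Longrightarrow> F w T0 = monomial w"
      "\<And>w T x. w \<in> ?W \<Longrightarrow> V T x \<Longrightarrow> F w T x = 0"
    and c: "\<And>w v. w \<in> ?W \<Longrightarrow> complex_poly_fun (c w v)"
      "\<And>w T x. w \<in> ?W \<Longrightarrow> F w T x = (\<Sum>v\<in>?W. c w v T * monomial v x)"
    unfolding P_def by blast+
  \<comment> \<open>The coefficients at \<open>T0\<close> need not form the identity matrix, as
    different words can give the same monomial. The correction leaves the sum over words unchanged
    because \<open>F w T0\<close> is \<open>monomial w\<close>.\<close>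
  define M where "M w v T = c w v T - c w v T0 + of_bool (w = v)" for w v T
  have "complex_poly_fun (M w v)" if "w \<in> ?W" for w v
    unfolding M_def[abs_def] using c(1)[OF that]
    by (intro complex_poly_fun.add complex_poly_fun_diff complex_poly_fun.const)
  moreover have "M w v T0 = of_bool (w = v)" for w v by (simp add: M_def)
  ultimately obtain g where g: "complex_poly_fun g" "g T0 = 1"
    "\<And>T y. g T \<noteq> 0 \<Longrightarrow> \<forall>w\<in>?W. (\<Sum>v\<in>?W. M w v T * y v) = 0 \<Longrightarrow> \<forall>v\<in>?W. y v = 0"
    using linear_system_near_identity[of ?W M T0, OF finite_words] by blast
  have "x = 0" if T: "g T \<noteq> 0" and V: "V T x" for T x
  proof -
    have "(\<Sum>v\<in>?W. M w v T * monomial v x) = 0" if w: "w \<in> ?W" for w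
    proof -
      have "(\<Sum>v\<in>?W. of_bool (w = v) * monomial v x) = monomial w x"
        using w by (simp add: finite_words of_bool_def if_distrib[of "\<lambda>a. a * _"] cong: if_cong)
      then have "(\<Sum>v\<in>?W. M w v T * monomial v x) = F w T x - F w T0 x + monomial w x"
        using c(2)[OF w] by (simp add: M_def sum.distrib sum_subtractf distrib_right left_diff_distrib)
      then show ?thesis using F w V by simp
    qed
    then have "monomial (replicate N i) x = 0" for i
      using g(3)[OF T, of "\<lambda>v. monomial v x"] by simp
    then have "(x $ i) ^ N = 0" for i
      by (simp add: monomial_def)
    then show "x = 0" by (simp add: vec_eq_iff)
  qed
  then show ?thesis using g by (intro exI[of _ g]) auto
qed

section \<open>The chain tensor\<close>

definition enum :: "nat \<Rightarrow> 'n::finite" where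
  "enum = (SOME e. bij_betw e {..<CARD('n)} UNIV)"

definition index :: "'n::finite \<Rightarrow> nat" where
  "index = inv_into {..<CARD('n)} enum"

lemma bij_betw_enum: "bij_betw enum {..<CARD('n)} (UNIV :: 'n::finite set)"
proof -
  have "\<exists>e. bij_betw e {..<CARD('n)} (UNIV :: 'n set)"
    using ex_bij_betw_nat_finite[of "UNIV :: 'n set"] by (simp add: atLeast0LessThan)
  then show ?thesis unfolding enum_def by (rule someI_ex)
qed

lemma index_enum [simp]: "k < CARD('n) \<Longrightarrow> index (enum k :: 'n::finite) = k"
  unfolding index_def using bij_betw_enum[where 'n = 'n] by (simp add: bij_betw_inv_into_left)

lemma enum_index [simp]: "enum (index (i :: 'n::finite)) = i"
  using bij_betw_inv_into_right[OF bij_betw_enum[where 'n = 'n], of i] by (simp add: index_def)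

lemma index_less [simp]: "index (i :: 'n::finite) < CARD('n)"
proof -
  have "i \<in> enum ` {..<CARD('n)}"
    using bij_betw_enum[where 'n = 'n] by (simp add: bij_betw_def)
  from inv_into_into[OF this] show ?thesis by (simp add: index_def)
qed

text \<open>
  Shifting the coordinates to the positions \<open>1, \<dots>, CARD('n)\<close> and padding by zeros makes one
  formula hold for all quadrics of the chain tensor below, including the first and the last one.
\<close>

definition padded :: "complex ^ 'n::finite \<Rightarrow> nat \<Rightarrow> complex" where
  "padded x k = (if k = 0 \<or> CARD('n) < k then 0 else x $ enum (k - 1))"

lemma padded_0 [simp]: "padded x 0 = 0"
  by (simp add: padded_def)

lemma padded_beyond: "CARD('n) < k \<Longrightarrow> padded (x :: complex ^ 'n::finite) k = 0"
  by (simp add: padded_def)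

lemma padded_index [simp]: "padded x (Suc (index (i :: 'n::finite))) = x $ i"
proof -
  have "\<not> CARD('n) < Suc (index i)" using index_less[of i] by linarith
  then show ?thesis by (simp add: padded_def)
qed

lemma padded_1: "padded x (Suc 0) = x $ enum 0"
  by (simp add: padded_def)

lemma padded_add: "padded (x + y) k = padded x k + padded y k"
  by (simp add: padded_def)

lemma padded_vec:
  assumes "X 0 = 0" "\<And>k. CARD('n) < k \<Longrightarrow> X k = 0"
  shows "padded (\<chi> i :: 'n::finite. X (Suc (index i))) = X"
proof
  show "padded (\<chi> i :: 'n. X (Suc (index i))) k = X k" for k
    using assms by (cases k) (auto simp: padded_def)
qed

text \<open>
  If \<open>\<Lambda>\<close> is an antisymmetric matrix of linear forms, then the quadrics \<open>Q = \<Lambda>(x) x\<close> satisfy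
  \<open>\<Sum>k. x $ k * Q k = 0\<close> and hence belong to a cyclic-symmetric tensor. For the chain tensor,
  \<open>\<Lambda>\<close> is tridiagonal with entries \<open>\<plusminus>(x $ k + x $ (k + 1))\<close>.
\<close>

definition chain_tensor :: "('n::finite) tensor3" where
  "chain_tensor = (let c = (\<lambda>k j. of_bool (index j = Suc (index k)) - of_bool (index k = Suc (index j)));
      l = (\<lambda>k j i. c k j * (of_bool (i = k) + of_bool (i = j)))
    in (\<chi> t. case t of (i, j, k) \<Rightarrow> (l k j i + l k i j) / 2))"

text \<open>By antisymmetry of \<open>l\<close> in its first two arguments, the six terms of the
  cyclic sum cancel in pairs.\<close>

lemma chain_tensor_cyclic: "(chain_tensor :: ('n::finite) tensor3) \<in> cyclic_symmetric_tensors"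
proof -
  define c :: "'n \<Rightarrow> 'n \<Rightarrow> complex" where
    "c k j = of_bool (index j = Suc (index k)) - of_bool (index k = Suc (index j))" for k j
  define l where "l k j i = c k j * (of_bool (i = k) + of_bool (i = j))" for k j i
  have l: "l j k i = - l k j i" for i j k
    by (simp add: l_def c_def algebra_simps)
  have T: "chain_tensor $ (i, j, k) = (l k j i + l k i j) / 2" for i j k :: 'n
    by (simp add: chain_tensor_def l_def c_def Let_def)
  have "chain_tensor $ (i, j, k) + chain_tensor $ (j, k, i) + chain_tensor $ (k, i, j) = 0" for i j k :: 'n
    unfolding T l[of j k i] l[of i k j] l[of j i k] by (simp add: field_simps)
  moreover have "chain_tensor $ (i, j, k) = chain_tensor $ (j, i, k)" for i j k :: 'n
    unfolding T by (simp only: add.commute)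
  ultimately show ?thesis
    unfolding cyclic_symmetric_tensors_def by blast
qed

lemma sum_index_eq:
  "(\<Sum>j\<in>UNIV. of_bool (index (j :: 'n::finite) = m) * f j)
    = (if m < CARD('n) then f (enum m) else (0 :: complex))"
proof (cases "m < CARD('n)")
  case True
  then have "(\<Sum>j\<in>UNIV. of_bool (index j = m) * f j) = (\<Sum>j\<in>UNIV. if j = enum m then f j else 0)"
    by (intro sum.cong) auto
  then show ?thesis using True by simp
next
  case False
  then have "(\<Sum>j\<in>UNIV. of_bool (index (j :: 'n) = m) * f j) = 0"
    by (intro sum.neutral) (use index_less in \<open>force simp: of_bool_def\<close>)
  then show ?thesis using False by simp
qed

text \<open>With a, b, c the padded coordinates at m, m + 1, m + 2, the matrix of linear forms gives
  c (b + c) - a (a + b), which equals (c - a) (a + b + c). Sums of neighbouring coordinates are its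
  entries for the sake of this factorization.\<close>

lemma quadric_chain_tensor:
  assumes "m < CARD('n::finite)"
  shows "quadric chain_tensor (enum m) (x :: complex ^ 'n)
    = (padded x (m + 2) - padded x m) * (padded x m + padded x (m + 1) + padded x (m + 2))"
proof -
  define k :: 'n where "k = enum m"
  define c where "c j = (of_bool (index j = Suc m) - of_bool (m = Suc (index j)) :: complex)" for j :: 'n
  define l where "l j i = c j * (of_bool (i = k) + of_bool (i = j))" for i j
  have T: "chain_tensor $ (i, j, k) = (l j i + l i j) / 2" for i j
    using assms by (simp add: chain_tensor_def l_def c_def Let_def k_def)
  have "(\<Sum>i\<in>UNIV. \<Sum>j\<in>UNIV. l i j * x $ i * x $ j) = (\<Sum>i\<in>UNIV. \<Sum>j\<in>UNIV. l j i * x $ i * x $ j)"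
    by (subst sum.swap) (simp add: mult_ac)
  then have "quadric chain_tensor k x = (\<Sum>i\<in>UNIV. \<Sum>j\<in>UNIV. l j i * x $ i * x $ j)"
    by (simp add: quadric_eq T add_divide_distrib distrib_right sum.distrib flip: sum_divide_distrib)
  also have "\<dots> = (\<Sum>j\<in>UNIV. \<Sum>i\<in>UNIV. l j i * x $ i * x $ j)"
    by (rule sum.swap)
  also have "\<dots> = (\<Sum>j\<in>UNIV. c j * (x $ j * (x $ k + x $ j)))"
  proof (rule sum.cong[OF refl])
    fix j
    have "(\<Sum>i\<in>UNIV. l j i * x $ i * x $ j)
        = (\<Sum>i\<in>UNIV. of_bool (i = k) * (c j * x $ i * x $ j)) + (\<Sum>i\<in>UNIV. of_bool (i = j) * (c j * x $ i * x $ j))"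
      by (simp add: l_def algebra_simps sum.distrib)
    moreover have "(\<Sum>i\<in>UNIV. of_bool (i = m) * (c j * x $ i * x $ j)) = c j * x $ m * x $ j" for m
      by (simp add: of_bool_def if_distrib[of "\<lambda>a. a * _"] cong: if_cong)
    ultimately show "(\<Sum>i\<in>UNIV. l j i * x $ i * x $ j) = c j * (x $ j * (x $ k + x $ j))"
      by (simp add: algebra_simps)
  qed
  also have "\<dots> = (\<Sum>j\<in>UNIV. of_bool (index j = Suc m) * (x $ j * (x $ k + x $ j)))
      - (\<Sum>j\<in>UNIV. of_bool (m = Suc (index j)) * (x $ j * (x $ k + x $ j)))"
    by (simp add: c_def left_diff_distrib sum_subtractf)
  also have "(\<Sum>j\<in>UNIV. of_bool (index j = Suc m) * (x $ j * (x $ k + x $ j)))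
      = padded x (m + 2) * (padded x (m + 1) + padded x (m + 2))"
    unfolding sum_index_eq using assms by (auto simp: padded_def k_def)
  also have "(\<Sum>j\<in>UNIV. of_bool (m = Suc (index j)) * (x $ j * (x $ k + x $ j)))
      = padded x m * (padded x m + padded x (m + 1))"
  proof (cases m)
    case 0
    then show ?thesis by simp
  next
    case (Suc m')
    then show ?thesis using sum_index_eq[of m' "\<lambda>j. x $ j * (x $ k + x $ j)"] assms
      by (auto simp: padded_def k_def eq_commute algebra_simps)
  qed
  finally show ?thesis by (simp add: k_def algebra_simps)
qed

lemma quadric_chain_tensor_zero_iff:
  "(\<forall>k. quadric chain_tensor k x = 0) \<longleftrightarrow> (\<forall>m<CARD('n). padded x (m + 2) = padded x m
      \<or> padded x (m + 2) = - padded x m - padded x (m + 1))"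
  for x :: "complex ^ 'n::finite"
proof -
  have eq: "quadric chain_tensor (enum m) x = 0 \<longleftrightarrow> padded x (m + 2) = padded x m
      \<or> padded x (m + 2) = - padded x m - padded x (m + 1)" if "m < CARD('n)" for m
  proof -
    have "padded x m + padded x (m + 1) + padded x (m + 2) = 0
        \<longleftrightarrow> padded x (m + 2) = - padded x m - padded x (m + 1)"
      by (auto simp: algebra_simps add_eq_0_iff)
    then show ?thesis using that by (simp add: quadric_chain_tensor)
  qed
  show ?thesis
    using eq by (metis enum_index index_less)
qed

lemma quadric_jacobian_chain_tensor:
  assumes "m < CARD('n::finite)"
  shows "(quadric_jacobian chain_tensor (x :: complex ^ 'n) *v y) $ enum m
    = (padded y (m + 2) - padded y m) * (padded x m + padded x (m + 1) + padded x (m + 2))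
    + (padded x (m + 2) - padded x m) * (padded y m + padded y (m + 1) + padded y (m + 2))"
proof -
  have "(quadric_jacobian chain_tensor x *v y) $ enum m = quadric chain_tensor (enum m) (x + y)
      - quadric chain_tensor (enum m) x - quadric chain_tensor (enum m) y"
    by (simp add: quadric_add[OF chain_tensor_cyclic])
  then show ?thesis
    unfolding quadric_chain_tensor[OF assms] padded_add by (simp add: algebra_simps)
qed

section \<open>Counting the base points of the chain tensor\<close>

definition walk_states :: "(complex \<times> complex) set" where
  "walk_states = {(0, 1), (0, -1), (1, 0), (-1, 0), (1, -1), (-1, 1)}"

text \<open>A state consists of two of the three values 0, 1, -1, and - a - b is the third. A step
  therefore appends either value other than b. That the two choices differ serves both the count and
  the nondegeneracy.\<close>

lemma walk_statesD:
  assumes "(a, b) \<in> walk_states"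
  shows "(b, a) \<in> walk_states" "(b, - a - b) \<in> walk_states" "a \<noteq> - a - b"
  using assms by (auto simp: walk_states_def)

text \<open>For positive \<open>m\<close> the last of the \<open>m\<close> steps produces
  \<open>X (m + 1)\<close>. The final clause forces this entry to be 0 and also fixes the tail, so
  that each walk is represented by exactly one function.\<close>

definition walks :: "nat \<Rightarrow> complex \<Rightarrow> complex \<Rightarrow> (nat \<Rightarrow> complex) set" where
  "walks m a b = {X. X 0 = a \<and> X 1 = b \<and> (\<forall>k<m. X (k + 2) = X k \<or> X (k + 2) = - X k - X (k + 1))
    \<and> (\<forall>k>m. X k = 0)}"

lemma walks_states:
  assumes "X \<in> walks m a b" "(a, b) \<in> walk_states" "k \<le> m"
  shows "(X k, X (Suc k)) \<in> walk_states"
  using assms(3)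
proof (induction k)
  case 0
  then show ?case using assms by (simp add: walks_def)
next
  case (Suc k)
  then have "X (k + 2) = X k \<or> X (k + 2) = - X k - X (k + 1)"
    using assms(1) by (simp add: walks_def)
  then show ?case using Suc walk_statesD[of "X k" "X (Suc k)"] by auto
qed

lemma walks_0: "walks 0 a b = (if b = 0 then {case_nat a (\<lambda>_. 0)} else {})"
  by (auto simp: walks_def fun_eq_iff split: nat.split)

lemma walks_Suc: "walks (Suc m) a b = case_nat a ` walks m b a \<union> case_nat a ` walks m b (- a - b)"
proof (intro equalityI subsetI)
  fix X assume X: "X \<in> walks (Suc m) a b"
  have "X = case_nat a (\<lambda>k. X (Suc k))"
    using X by (auto simp: walks_def fun_eq_iff split: nat.split)
  moreover have "(\<lambda>k. X (Suc k)) \<in> walks m b (X 2)"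
    using X by (auto simp: walks_def numeral_2_eq_2)
  moreover have "X 2 = a \<or> X 2 = - a - b"
    using X by (auto simp: walks_def numeral_2_eq_2)
  ultimately show "X \<in> case_nat a ` walks m b a \<union> case_nat a ` walks m b (- a - b)"
    by auto
next
  fix X assume "X \<in> case_nat a ` walks m b a \<union> case_nat a ` walks m b (- a - b)"
  then obtain Y c where Y: "X = case_nat a Y" "Y \<in> walks m b c" "c = a \<or> c = - a - b"
    by auto
  then show "X \<in> walks (Suc m) a b"
    by (auto simp: walks_def less_Suc_eq_0_disj split: nat.split)
qed

lemma card_walks_Suc:
  assumes "(a, b) \<in> walk_states" "finite (walks m b a)" "finite (walks m b (- a - b))"
  shows "finite (walks (Suc m) a b)"
    "card (walks (Suc m) a b) = card (walks m b a) + card (walks m b (- a - b))"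
proof -
  have inj: "inj_on (case_nat a) A" for A :: "(nat \<Rightarrow> complex) set"
    by (rule inj_onI) (metis Nitpick.case_nat_unfold diff_Suc_1 ext nat.simps(3) nat.case(2))
  have "walks m b a \<inter> walks m b (- a - b) = {}"
    using walk_statesD(3)[OF assms(1)] by (auto simp: walks_def)
  moreover have "inj (case_nat a :: (nat \<Rightarrow> complex) \<Rightarrow> _)" by (rule inj)
  ultimately have "case_nat a ` walks m b a \<inter> case_nat a ` walks m b (- a - b) = {}"
    by (metis image_Int image_empty)
  then show "card (walks (Suc m) a b) = card (walks m b a) + card (walks m b (- a - b))"
    using assms by (simp add: walks_Suc card_Un_disjoint card_image[OF inj])
  show "finite (walks (Suc m) a b)"
    using assms by (simp add: walks_Suc)
qed

text \<open>These are paths on the triangle with vertices 0, 1, -1. A state with b = 0 has two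
  successors with nonzero second entry; every other state has one successor of each kind, which
  produces the recursion. For m = 0 and b = 0 the walk has already arrived, whence the separate
  value 1.\<close>

lemma card_walks:
  assumes "(a, b) \<in> walk_states"
  shows "finite (walks m a b) \<and> card (walks m a b) =
    (if b = 0 then (case m of 0 \<Rightarrow> 1 | Suc m' \<Rightarrow> 2 * jacobsthal m') else jacobsthal m)"
  using assms
proof (induction m arbitrary: a b)
  case 0
  then show ?case by (auto simp: walks_0)
next
  case (Suc m)
  note st = walk_statesD(1,2)[OF Suc.prems]
  note c = card_walks_Suc[OF Suc.prems conjunct1[OF Suc.IH[OF st(1)]] conjunct1[OF Suc.IH[OF st(2)]]]
  have "card (walks (Suc m) a b) = (if b = 0 then 2 * jacobsthal m else jacobsthal (Suc m))"
    unfolding c(2) using Suc.IH[OF st(1)] Suc.IH[OF st(2)] Suc.prems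
    by (cases m) (auto simp: walk_states_def)
  then show ?case using c(1) by simp
qed

lemma chart_zeros_chain_tensor:
  "bij_betw padded (chart_zeros (enum 0) (chain_tensor :: 'n::finite tensor3)) (walks CARD('n) 0 1)"
proof (rule bij_betwI[where g = "\<lambda>X. \<chi> i. X (Suc (index i))"])
  show "padded \<in> chart_zeros (enum 0) (chain_tensor :: 'n tensor3) \<rightarrow> walks CARD('n) 0 1"
    by (auto simp: chart_zeros_def walks_def quadric_chain_tensor_zero_iff padded_beyond padded_1)
  have *: "padded (\<chi> i. X (Suc (index (i :: 'n)))) = X" if "X \<in> walks CARD('n) 0 1" for X
    using that by (intro padded_vec) (auto simp: walks_def)
  show "(\<lambda>X. \<chi> i. X (Suc (index i))) \<in> walks CARD('n) 0 1 \<rightarrow> chart_zeros (enum 0) (chain_tensor :: 'n tensor3)"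
  proof
    fix X assume X: "X \<in> walks CARD('n) 0 1"
    then show "(\<chi> i. X (Suc (index i))) \<in> chart_zeros (enum 0) (chain_tensor :: 'n tensor3)"
      unfolding chart_zeros_def mem_Collect_eq quadric_chain_tensor_zero_iff *[OF X]
      by (simp add: walks_def)
  qed
  show "(\<chi> i. padded x (Suc (index i))) = x" for x :: "complex ^ 'n"
    by (simp add: vec_eq_iff)
  show "padded (\<chi> i. X (Suc (index (i :: 'n)))) = X" if "X \<in> walks CARD('n) 0 1" for X
    using * that .
qed

lemma card_chart_zeros_chain_tensor:
  "finite (chart_zeros (enum 0) (chain_tensor :: 'n::finite tensor3))"
  "card (chart_zeros (enum 0) (chain_tensor :: 'n::finite tensor3)) = jacobsthal CARD('n)"
  using chart_zeros_chain_tensor[where 'n = 'n] card_walks[of 0 1 "CARD('n)"]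
  by (auto simp: bij_betw_finite bij_betw_same_card walk_states_def)

text \<open>
  At a base point x both kernels of the Jacobian contain x. If these kernels are spanned by x and
  the coordinate a of x is nonzero, then increasing the diagonal entry of index a makes
  the Jacobian invertible.
\<close>

definition augmented_jacobian ::
  "'n::finite \<Rightarrow> 'n tensor3 \<Rightarrow> complex ^ 'n \<Rightarrow> complex ^ 'n ^ 'n" where
  "augmented_jacobian a T x = (\<chi> k i. quadric_jacobian T x $ k $ i + (if k = a \<and> i = a then x $ a else 0))"

lemma augmented_jacobian_mult:
  "(augmented_jacobian a T x *v y) $ k = (quadric_jacobian T x *v y) $ k + (if k = a then x $ a * y $ a else 0)"
proof -
  have "(\<Sum>i\<in>UNIV. (if k = a \<and> i = a then x $ a else 0) * y $ i) = (if k = a then x $ a * y $ a else 0)"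
    by (simp add: if_distrib[of "\<lambda>c. c * _"] cong: if_cong)
  then show ?thesis
    by (simp add: augmented_jacobian_def matrix_vector_mult_def distrib_right sum.distrib)
qed

lemma det_nonzero_iff_kernel: "det A \<noteq> 0 \<longleftrightarrow> (\<forall>y. A *v y = 0 \<longrightarrow> y = 0)"
  for A :: "complex ^ 'n ^ 'n"
  by (metis invertible_det_nz invertible_left_inverse matrix_left_invertible_ker)

text \<open>Pairing a kernel equation with \<open>x\<close> from the left removes the Jacobian and
  leaves \<open>y $ enum 0 = 0\<close>. The two initial padded entries of \<open>y\<close> are then
  0, and each quadric forces the next one to vanish.\<close>

lemma det_augmented_chain_tensor:
  assumes "x \<in> chart_zeros (enum 0) (chain_tensor :: 'n::finite tensor3)"
  shows "det (augmented_jacobian (enum 0) chain_tensor x) \<noteq> 0"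
  unfolding det_nonzero_iff_kernel
proof (intro allI impI)
  fix y assume y: "augmented_jacobian (enum 0) chain_tensor x *v y = 0"
  let ?J = "quadric_jacobian chain_tensor x"
  have x: "x $ enum 0 = 1" "\<And>k. quadric chain_tensor k x = 0"
    using assms by (auto simp: chart_zeros_def)
  have J: "(?J *v y) $ k + (if k = enum 0 then y $ enum 0 else 0) = 0" for k
    using y augmented_jacobian_mult[of "enum 0" chain_tensor x y k] x by (simp split: if_splits)
  have "(\<Sum>k\<in>UNIV. x $ k * (?J *v y) $ k) = (\<Sum>i\<in>UNIV. (x v* ?J) $ i * y $ i)"
    unfolding matrix_vector_mult_def vector_matrix_mult_def
    by (simp add: sum_distrib_left sum_distrib_right mult_ac) (rule sum.swap)
  also have "\<dots> = 0"
    by (simp add: vector_mult_quadric_jacobian[OF chain_tensor_cyclic] x)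
  finally have "(\<Sum>k\<in>UNIV. x $ k * ((?J *v y) $ k + (if k = enum 0 then y $ enum 0 else 0))) = y $ enum 0"
    by (simp add: distrib_left sum.distrib x(1) if_distrib[of "(*) _"] cong: if_cong)
  then have y0: "y $ enum 0 = 0" by (simp add: J)
  then have J0: "(?J *v y) $ k = 0" for k using J[of k] by (simp split: if_splits)
  have walk: "padded x \<in> walks CARD('n) 0 1"
    using chart_zeros_chain_tensor assms by (auto simp: bij_betw_def)
  have "padded y k = 0 \<and> padded y (Suc k) = 0" if "k \<le> CARD('n)" for k
    using that
  proof (induction k)
    case 0
    then show ?case by (simp add: padded_1 y0)
  next
    case (Suc k)
    then have IH: "padded y k = 0" "padded y (Suc k) = 0" by auto
    have "(padded x k, padded x (Suc k)) \<in> walk_states"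
      using walks_states[OF walk, of k] Suc by (simp add: walk_states_def)
    then have ne: "padded x k \<noteq> - padded x k - padded x (Suc k)"
      by (rule walk_statesD)
    \<comment> \<open>This is the derivative of the quadric in its last variable, nonzero because
      the two roots in that variable are distinct.\<close>
    have "padded x (k + 1) + 2 * padded x (k + 2) \<noteq> 0"
    proof
      assume eq: "padded x (k + 1) + 2 * padded x (k + 2) = 0"
      have "padded x (k + 2) = padded x k \<or> padded x (k + 2) = - padded x k - padded x (k + 1)"
        using walk Suc by (simp add: walks_def)
      then show False
      proof
        assume "padded x (k + 2) = padded x k"
        then show False using ne eq by (simp add: algebra_simps eq_neg_iff_add_eq_0)
      next
        assume c: "padded x (k + 2) = - padded x k - padded x (k + 1)"
        show False using ne eq unfolding c by (simp add: algebra_simps eq_neg_iff_add_eq_0 neg_eq_iff_add_eq_0)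
      qed
    qed
    moreover have "padded y (k + 2) * (padded x (k + 1) + 2 * padded x (k + 2)) = 0"
      using quadric_jacobian_chain_tensor[of k x y] J0[of "enum k"] IH Suc.prems
      by (simp add: algebra_simps)
    ultimately have "padded y (k + 2) = 0"
      by simp
    then show ?case using IH by simp
  qed
  then have "padded y (Suc (index i)) = 0" for i :: 'n
    using index_less[of i] by (metis less_imp_le)
  then show "y = 0" by (simp add: vec_eq_iff)
qed

section \<open>A Nullstellensatz certificate for the chain tensor\<close>

lemma form_family_quadric: "form_family 2 (\<lambda>T x. quadric T k (x :: complex ^ 'n::finite))"
proof -
  have "form_family 2 (\<lambda>T x :: complex ^ 'n. \<Sum>i\<in>UNIV. \<Sum>j\<in>UNIV. T $ (i, j, k) * (x $ i * x $ j))"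
    using form_family.mult[OF form_family.coord form_family.coord]
    by (intro form_family_sum form_family_scale complex_poly_fun.coord) (simp add: numeral_2_eq_2)
  then show ?thesis by (simp add: quadric_eq mult.assoc)
qed

text \<open>Adding \<open>x $ a\<close> and not 1 to the diagonal keeps all entries linear in
  \<open>x\<close>, so that the determinant is a form and can join the quadrics as a
  generator.\<close>

lemma form_family_det_augmented:
  "form_family CARD('n) (\<lambda>T x. det (augmented_jacobian (a :: 'n::finite) T x))"
proof (rule form_family_det)
  fix k i :: 'n
  have "form_family 1 (\<lambda>T x :: complex ^ 'n. 2 * (\<Sum>j\<in>UNIV. T $ (i, j, k) * x $ j)
      + of_bool (k = a \<and> i = a) * x $ a)"
    by (intro form_family.add form_family_sum form_family_scale complex_poly_fun.coord
        complex_poly_fun.const form_family.coord)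
  then show "form_family 1 (\<lambda>T x. augmented_jacobian a T x $ k $ i)"
    by (simp add: augmented_jacobian_def quadric_jacobian_def of_bool_def if_distrib[of "\<lambda>c. c * _"] cong: if_cong)
qed

lemma graded_ideal_scale: "graded_ideal G d f \<Longrightarrow> graded_ideal G d (\<lambda>x. c * f x)"
  using graded_ideal.mult[OF form.const[of c]] by fastforce

lemma graded_ideal_diff:
  "graded_ideal G d f \<Longrightarrow> graded_ideal G d g \<Longrightarrow> graded_ideal G d (\<lambda>x. f x - g x)"
  using graded_ideal.add[OF _ graded_ideal_scale[of G d g "-1"]] by fastforce

lemma form_zero: "form d (\<lambda>x. 0)"
  using form_family_at[OF form_family_zero] by blast

lemma form_padded: "form 1 (\<lambda>x :: complex ^ 'n::finite. padded x k)"
  by (cases "k = 0 \<or> CARD('n) < k") (auto simp: padded_def form_zero form.coord[unfolded One_nat_def])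

lemma form_monomial: "form (length w) (monomial w)"
proof (induction w)
  case Nil
  show ?case using form.const[of 1] by (simp add: monomial_def[abs_def])
next
  case (Cons i w)
  show ?case using form.mult[OF form.coord[of i] Cons] by (simp add: monomial_def[abs_def])
qed

definition chain_factor :: "bool \<Rightarrow> nat \<Rightarrow> complex ^ 'n::finite \<Rightarrow> complex" where
  "chain_factor s k x = (if s then padded x (k + 2) - padded x k
    else padded x k + padded x (k + 1) + padded x (k + 2))"

lemma form_diff:
  assumes "form d f" "form d g"
  shows "form d (\<lambda>x. f x - g x)"
  using form.add[OF assms(1) form.mult[OF form.const[of "-1"] assms(2), simplified]] by simp

lemma form_chain_factor: "form 1 (chain_factor s k)"
  by (cases s; simp add: chain_factor_def[abs_def] del: One_nat_def)
    (intro form_diff form.add form_padded)+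

text \<open>
  Each quadric of the chain tensor is a product of two linear forms. A sequence \<open>s\<close> selects one
  factor of each of the first m quadrics. After all choices the ideal contains the ideal
  of a point, at which the determinant is nonzero, or all linear forms; the choices are then undone
  one at a time with \<open>graded_ideal_mult_split\<close>.
\<close>

definition chain_gens :: "(nat \<times> (complex ^ 'n::finite \<Rightarrow> complex)) set" where
  "chain_gens = insert (CARD('n), \<lambda>x. det (augmented_jacobian (enum 0) chain_tensor x))
    (range (\<lambda>k. (2, quadric chain_tensor k)))"

definition branch_gens :: "nat \<Rightarrow> (nat \<Rightarrow> bool) \<Rightarrow> (nat \<times> (complex ^ 'n::finite \<Rightarrow> complex)) set" where
  "branch_gens m s = chain_gens \<union> (\<lambda>k. (1, chain_factor (s k) k)) ` {..<m}"

text \<open>The solution of the chosen linear equations without the closing condition; the value at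
  \<open>CARD('n) + 1\<close> decides whether the branch is a point or empty.\<close>

fun walk :: "(nat \<Rightarrow> bool) \<Rightarrow> nat \<Rightarrow> complex" where
  "walk s 0 = 0"
| "walk s (Suc 0) = 1"
| "walk s (Suc (Suc k)) = (if s k then walk s k else - walk s k - walk s (Suc k))"

lemma branch_ideal_padded:
  assumes "k \<le> CARD('n::finite) + 1"
  shows "graded_ideal (branch_gens CARD('n) s) 1 (\<lambda>x :: complex ^ 'n. padded x k - walk s k * padded x 1)"
  using assms
proof (induction s k rule: walk.induct)
  case (1 s)
  show ?case using graded_ideal.zero by simp
next
  case (2 s)
  show ?case using graded_ideal.zero by simp
next
  case (3 s k)
  let ?I = "graded_ideal (branch_gens CARD('n) s) 1 :: (complex ^ 'n \<Rightarrow> complex) \<Rightarrow> bool"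
  have w: "?I (chain_factor (s k) k)"
    using 3 by (intro graded_ideal.gen) (simp add: branch_gens_def)
  show ?case
  proof (cases "s k")
    case True
    then have "?I (\<lambda>x. padded x k - walk s k * padded x 1)" using 3 by simp
    from graded_ideal.add[OF w this] True show ?thesis
      by (simp add: chain_factor_def)
  next
    case False
    then have "?I (\<lambda>x. padded x k - walk s k * padded x 1)"
      "?I (\<lambda>x. padded x (Suc k) - walk s (Suc k) * padded x 1)" using 3 by simp_all
    from graded_ideal_diff[OF graded_ideal_diff[OF w this(1)] this(2)] False show ?thesis
      by (simp add: chain_factor_def algebra_simps)
  qed
qed

text \<open>Modulo the branch ideal every coordinate is a constant multiple of the first one, so
  forms are determined by their value at the point of the branch.\<close>

lemma branch_ideal_form:
  assumes "form d f"
  shows "graded_ideal (branch_gens CARD('n) s) d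
    (\<lambda>x :: complex ^ 'n::finite. f x - f (\<chi> i. walk s (Suc (index i))) * padded x 1 ^ d)"
  using assms
proof induction
  case (const c)
  show ?case using graded_ideal.zero by simp
next
  case (coord i)
  have "Suc (index i) \<le> CARD('n) + 1" using index_less[of i] by linarith
  from branch_ideal_padded[OF this, of s] show ?case by simp
next
  case (add d f g)
  from graded_ideal.add[OF add.IH] show ?case by (simp add: algebra_simps)
next
  case (mult d f e g)
  let ?p = "\<chi> i. walk s (Suc (index i))"
  have X: "form (d * 1) (\<lambda>x :: complex ^ 'n. padded x 1 ^ d)"
  proof (induction d)
    case 0
    show ?case using form.const[of 1] by simp
  next
    case (Suc d)
    show ?case using form.mult[OF form_padded[of 1] Suc] by simp
  qed
  \<comment> \<open>With X the first coordinate and p the point, the product splits as g (f - f(p)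
    X^d) + f(p) X^d (g - g(p) X^e).\<close>
  have 1: "graded_ideal (branch_gens CARD('n) s) (d + e)
      (\<lambda>x. g x * (f x - f ?p * padded x 1 ^ d))"
    by (subst add.commute) (rule graded_ideal.mult[OF mult.hyps(2) mult.IH(1)])
  have 2: "graded_ideal (branch_gens CARD('n) s) (d + e)
      (\<lambda>x. f ?p * (padded x 1 ^ d * (g x - g ?p * padded x 1 ^ e)))"
    using graded_ideal_scale[OF graded_ideal.mult[OF X mult.IH(2)]] by simp
  from graded_ideal.add[OF 1 2] show ?case by (simp add: algebra_simps power_add)
qed

text \<open>If the branch closes up, its point is a base point; the determinant is nonzero there, so
  reducing it puts a power of the first coordinate into the ideal. Otherwise the entry beyond the
  last coordinate, which is 0 by padding, puts the first coordinate itself there.\<close>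

lemma full_branch_ideal:
  fixes w :: "'n::finite list"
  assumes "length w = CARD('n)"
  shows "graded_ideal (branch_gens CARD('n) s) CARD('n) (monomial w)"
proof -
  let ?n = "CARD('n)"
  let ?I = "graded_ideal (branch_gens ?n s) :: nat \<Rightarrow> (complex ^ 'n \<Rightarrow> complex) \<Rightarrow> bool"
  define p where "p = (\<chi> i :: 'n. walk s (Suc (index i)))"
  show ?thesis
  proof (cases "walk s (Suc ?n) = 0")
    case True
    have p: "padded p k = walk s k" if "k \<le> Suc ?n" for k
      using that True by (cases k) (auto simp: padded_def p_def le_Suc_eq)
    have "p \<in> chart_zeros (enum 0) chain_tensor"
      unfolding chart_zeros_def mem_Collect_eq quadric_chain_tensor_zero_iff
    proof (intro conjI allI impI)
      show "p $ enum 0 = 1" by (simp add: p_def)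
      show "padded p (m + 2) = padded p m \<or> padded p (m + 2) = - padded p m - padded p (m + 1)"
        if "m < ?n" for m using that by (simp add: p)
    qed
    let ?D = "\<lambda>x :: complex ^ 'n. det (augmented_jacobian (enum 0) chain_tensor x)"
    have Dp: "?D p \<noteq> 0" by (rule det_augmented_chain_tensor) fact
    have ID: "?I ?n ?D"
      by (rule graded_ideal.gen) (simp add: branch_gens_def chain_gens_def)
    have D: "form ?n ?D"
      using form_family_at[OF form_family_det_augmented] .
    have "?I ?n (\<lambda>x. ?D x - (?D x - ?D p * padded x 1 ^ ?n))"
      by (rule graded_ideal_diff[OF ID branch_ideal_form[OF D, of s, folded p_def]])
    from graded_ideal_scale[OF this, of "inverse (?D p)"] Dp
    have X: "?I ?n (\<lambda>x. padded x 1 ^ ?n)" by (simp add: mult.assoc[symmetric])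
    have "?I ?n (\<lambda>x. monomial w x - monomial w p * padded x 1 ^ ?n)"
      using branch_ideal_form[OF form_monomial[of w], of s] assms by (simp add: p_def)
    from graded_ideal.add[OF this graded_ideal_scale[OF X, of "monomial w p"]]
    show ?thesis by simp
  next
    case False
    have "?I 1 (\<lambda>x. padded x (Suc ?n) - walk s (Suc ?n) * padded x 1)"
      by (rule branch_ideal_padded) simp
    from graded_ideal_scale[OF this, of "- inverse (walk s (Suc ?n))"] False
    have X: "?I 1 (\<lambda>x. padded x 1)" by (simp add: padded_beyond mult.assoc[symmetric])
    obtain i v where w: "w = i # v" "length v = ?n - 1"
      using assms by (cases w) auto
    have "?I 1 (\<lambda>x. x $ i - p $ i * padded x 1)"
      using branch_ideal_form[OF form.coord[of i], of s] by (simp add: p_def)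
    from graded_ideal.add[OF this graded_ideal_scale[OF X, of "p $ i"]]
    have "?I 1 (\<lambda>x. x $ i)" by simp
    from graded_ideal.mult[OF form_monomial this, of v]
    show ?thesis using w(2) by (simp add: w(1) monomial_def[abs_def] mult.commute)
  qed
qed

text \<open>One half of the word uses the first factor of the quadric and the other half the second,
  at the cost of doubling the degree.\<close>

lemma branch_ideal_descent:
  assumes "m < CARD('n)"
    and "\<And>s w. length w = N \<Longrightarrow> graded_ideal (branch_gens (Suc m) s) N (monomial (w :: 'n list))"
    and "length w = N + N"
  shows "graded_ideal (branch_gens m s) (N + N) (monomial (w :: 'n::finite list))"
proof -
  have gens: "branch_gens (Suc m) (s(m := b)) = insert (1, chain_factor b m) (branch_gens m s)" for b
    by (auto simp: branch_gens_def lessThan_Suc)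
  have w: "length (take N w) = N" "length (drop N w) = N" using assms(3) by auto
  have "graded_ideal (branch_gens m s) (N + N) (\<lambda>x. monomial (take N w) x * monomial (drop N w) x)"
  proof (rule graded_ideal_mult_split)
    show "graded_ideal (insert (1, chain_factor True m) (branch_gens m s)) N (monomial (take N w))"
      using assms(2)[OF w(1), of "s(m := True)"] by (simp only: gens)
    show "graded_ideal (insert (1, chain_factor False m) (branch_gens m s)) N (monomial (drop N w))"
      using assms(2)[OF w(2), of "s(m := False)"] by (simp only: gens)
    show "form N (monomial (take N w))" using form_monomial[of "take N w"] w(1) by simp
    show "form 1 (chain_factor False m :: complex ^ 'n \<Rightarrow> complex)" by (rule form_chain_factor)
    have "(\<lambda>x. chain_factor True m x * chain_factor False m x) = quadric chain_tensor (enum m :: 'n)"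
      using assms(1) by (simp add: fun_eq_iff chain_factor_def quadric_chain_tensor)
    then show "graded_ideal (branch_gens m s) 2
        (\<lambda>x :: complex ^ 'n. chain_factor True m x * chain_factor False m x)"
      by (intro graded_ideal.gen) (simp add: branch_gens_def chain_gens_def)
  qed
  then show ?thesis by (simp flip: monomial_append)
qed

text \<open>Undoing all choices starting from degree n leads to N = n 2^n. The result certifies that
  the quadrics and the determinant have no common projective zero.\<close>

lemma chain_ideal:
  "\<exists>N. \<forall>w. length w = N \<longrightarrow> graded_ideal chain_gens N (monomial (w :: 'n::finite list))"
proof -
  have "\<exists>N. \<forall>s w. length w = N \<longrightarrow>
      graded_ideal (branch_gens (CARD('n) - m) s) N (monomial (w :: 'n list))"
    if "m \<le> CARD('n)" for m
    using that
  proof (induction m)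
    case 0
    then show ?case using full_branch_ideal by auto
  next
    case (Suc m)
    then obtain N where N: "\<And>s w. length w = N \<Longrightarrow>
      graded_ideal (branch_gens (CARD('n) - m) s) N (monomial (w :: 'n list))" by auto
    have "CARD('n) - m = Suc (CARD('n) - Suc m)" using Suc.prems by simp
    then have "graded_ideal (branch_gens (CARD('n) - Suc m) s) (N + N) (monomial w)"
      if "length w = N + N" for s and w :: "'n list"
      using that N Suc.prems by (intro branch_ideal_descent) simp_all
    then show ?case by blast
  qed
  from this[of "CARD('n)"] show ?thesis by (simp add: branch_gens_def)
qed

section \<open>Invariance of the number of base points\<close>

lemma has_derivative_vecI:
  fixes f :: "'a::real_normed_vector \<Rightarrow> 'b::euclidean_space ^ 'n"
  assumes "\<And>i. ((\<lambda>x. f x $ i) has_derivative (\<lambda>h. f' h $ i)) (at a within S)"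
  shows "(f has_derivative f') (at a within S)"
  unfolding has_derivative_componentwise_within[of f]
  by (auto simp: Basis_vec_def inner_axis intro!: has_derivative_inner_left assms)

lemma has_derivative_quadric:
  assumes "T \<in> cyclic_symmetric_tensors"
  shows "(quadric T k has_derivative (\<lambda>h. (quadric_jacobian T x *v h) $ k)) (at x within S)"
proof -
  have "((\<lambda>x. \<Sum>i\<in>UNIV. \<Sum>j\<in>UNIV. T $ (i, j, k) * (x $ i * x $ j)) has_derivative
      (\<lambda>h. \<Sum>i\<in>UNIV. \<Sum>j\<in>UNIV. T $ (i, j, k) * (x $ i * h $ j + h $ i * x $ j))) (at x within S)"
    by (intro has_derivative_sum has_derivative_mult_right has_derivative_mult
        bounded_linear_imp_has_derivative bounded_linear_vec_nth)
  then show ?thesis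
    by (simp add: quadric_jacobian_mult[OF assms] quadric_eq[abs_def] mult.assoc)
qed

lemma continuous_on_quadric [continuous_intros]:
  assumes "continuous_on S T" "continuous_on S f"
  shows "continuous_on S (\<lambda>z. quadric (T z) k (f z))"
  unfolding quadric_eq by (intro continuous_intros assms)

lemma continuous_on_quadric_jacobian [continuous_intros]:
  assumes "continuous_on S f"
  shows "continuous_on S (\<lambda>z. (quadric_jacobian T (f z) *v h) $ k)"
  unfolding quadric_jacobian_def matrix_vector_mult_def by (simp, intro continuous_intros assms)

lemma tendsto_quadric:
  assumes "(T \<longlongrightarrow> T0) F" "(f \<longlongrightarrow> x) F"
  shows "((\<lambda>z. quadric (T z) k (f z)) \<longlongrightarrow> quadric T0 k x) F"
  unfolding quadric_eq by (intro tendsto_intros assms)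

lemma quadric_pencil: "quadric (A + s *s B) k x = quadric A k x + s * quadric B k x"
  by (simp add: quadric_eq distrib_right sum.distrib sum_distrib_left mult.assoc)

lemma quadric_jacobian_pencil:
  "(quadric_jacobian (A + s *s B) x *v y) $ k
    = (quadric_jacobian A x *v y) $ k + s * (quadric_jacobian B x *v y) $ k"
  by (simp add: quadric_jacobian_def matrix_vector_mult_def distrib_left distrib_right sum.distrib
      sum_distrib_left sum_distrib_right mult_ac)

lemma cyclic_symmetric_tensors_pencil:
  assumes "A \<in> cyclic_symmetric_tensors" "B \<in> cyclic_symmetric_tensors"
  shows "A + s *s B \<in> cyclic_symmetric_tensors"
proof -
  have "(A + s *s B) $ (i, j, k) + (A + s *s B) $ (j, k, i) + (A + s *s B) $ (k, i, j)
    = (A $ (i, j, k) + A $ (j, k, i) + A $ (k, i, j)) + s * (B $ (i, j, k) + B $ (j, k, i) + B $ (k, i, j))"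
    for i j k by (simp add: algebra_simps)
  moreover have "(A + s *s B) $ (i, j, k) = (A + s *s B) $ (j, i, k)" for i j k
    using cyclic_symmetric_tensorsD(2)[OF assms(1), of i j k] cyclic_symmetric_tensorsD(2)[OF assms(2), of i j k]
    by simp
  ultimately show ?thesis
    unfolding cyclic_symmetric_tensors_def mem_Collect_eq
    by (metis add_0 cyclic_symmetric_tensorsD(1)[OF assms(1)]
        cyclic_symmetric_tensorsD(1)[OF assms(2)] mult_zero_right)
qed

text \<open>Evaluating the Jacobian between \<open>x\<close> and \<open>x\<close> by its right and
  by its left action shows that twice the sum equals minus the sum.\<close>

lemma sum_coordinate_quadric:
  assumes "T \<in> cyclic_symmetric_tensors"
  shows "(\<Sum>k\<in>UNIV. x $ k * quadric T k x) = 0"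
proof -
  have "(\<Sum>k\<in>UNIV. x $ k * (quadric_jacobian T x *v x) $ k)
      = (\<Sum>i\<in>UNIV. (x v* quadric_jacobian T x) $ i * x $ i)"
    unfolding matrix_vector_mult_def vector_matrix_mult_def
    by (simp add: sum_distrib_left sum_distrib_right mult_ac) (subst sum.swap, simp add: mult_ac)
  then have "2 * (\<Sum>k\<in>UNIV. x $ k * quadric T k x) = - (\<Sum>k\<in>UNIV. x $ k * quadric T k x)"
    by (simp add: quadric_jacobian_mult_self vector_mult_quadric_jacobian[OF assms] sum_negf
        sum_distrib_left mult_ac)
  then have "3 * (\<Sum>k\<in>UNIV. x $ k * quadric T k x) = 0"
    by (simp add: eq_neg_iff_add_eq_0 flip: distrib_right[of 2 1, simplified])
  then show ?thesis by simp
qed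

definition regular :: "'n::finite \<Rightarrow> 'n tensor3 \<Rightarrow> bool" where
  "regular a T \<longleftrightarrow> (\<forall>x. x \<noteq> 0 \<longrightarrow> (\<forall>k. quadric T k x = 0) \<longrightarrow> det (augmented_jacobian a T x) \<noteq> 0)"

text \<open>For \<open>x $ a = 0\<close> the added diagonal entry contributes nothing and
  \<open>x\<close> remains in the kernel. Regularity thus controls the chart together with
  nondegeneracy.\<close>

lemma regular_coordinate:
  assumes "regular a T" "x \<noteq> 0" "\<And>k. quadric T k x = 0"
  shows "x $ a \<noteq> 0"
proof
  assume "x $ a = 0"
  then have "augmented_jacobian a T x *v x = 0"
    using assms(3) by (simp add: vec_eq_iff augmented_jacobian_mult quadric_jacobian_mult_self)
  then show False
    using assms unfolding regular_def by (metis det_nonzero_iff_kernel)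
qed

text \<open>The chart \<open>x $ a = 1\<close> is not compact, but regularity excludes zeros at infinity.\<close>

lemma chart_zeros_compactness:
  assumes "regular a T0" "T \<longlonglongrightarrow> T0" "\<And>m. x m \<in> chart_zeros a (T m)"
  obtains r l where "strict_mono r" "l \<in> chart_zeros a T0" "(x \<circ> r) \<longlonglongrightarrow> l"
proof -
  define c where "c m = complex_of_real (norm (x m))" for m
  define y where "y m = inverse (c m) *s x m" for m
  have x: "x m $ a = 1" "\<And>k. quadric (T m) k (x m) = 0" for m
    using assms(3) by (auto simp: chart_zeros_def)
  then have "x m \<noteq> 0" for m by (metis zero_index zero_neq_one)
  then have c: "c m \<noteq> 0" for m by (simp add: c_def)
  have y: "norm (y m) = 1" for m
  proof -
    have "y m = inverse (norm (x m)) *\<^sub>R x m"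
      by (simp add: y_def c_def vec_eq_iff) (simp add: scaleR_conv_of_real)
    then show ?thesis using \<open>x m \<noteq> 0\<close> by simp
  qed
  obtain l r where lr: "l \<in> sphere 0 1" "strict_mono r" "(y \<circ> r) \<longlonglongrightarrow> l"
    using compact_sphere[of "0 :: complex ^ 'a" 1] y unfolding compact_def
    by (metis dist_0_norm mem_sphere)
  have Tr: "(\<lambda>m. T (r m)) \<longlonglongrightarrow> T0"
    using LIMSEQ_subseq_LIMSEQ[OF assms(2) lr(2)] by (simp add: o_def)
  have yr: "(\<lambda>m. y (r m)) \<longlonglongrightarrow> l" using lr(3) by (simp add: o_def)
  have "quadric T0 k l = 0" for k
  proof -
    have "(\<lambda>m. quadric (T (r m)) k (y (r m))) \<longlonglongrightarrow> quadric T0 k l"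
      by (intro tendsto_quadric Tr yr)
    moreover have "quadric (T m) k (y m) = 0" for m
      by (simp add: y_def quadric_scale x)
    ultimately show ?thesis by (simp add: LIMSEQ_const_iff)
  qed
  moreover have "l \<noteq> 0" using lr(1) by auto
  ultimately have la: "l $ a \<noteq> 0" using regular_coordinate assms(1) by blast
  \<comment> \<open>A chart point is recovered from its normalization by division by coordinate
    \<open>a\<close>, which stays away from 0 in the limit.\<close>
  have "x m = inverse (y m $ a) *s y m" for m
    using c[of m] x(1)[of m] by (simp add: y_def vec_eq_iff)
  moreover have "(\<lambda>m. inverse (y (r m) $ a) *s y (r m)) \<longlonglongrightarrow> inverse (l $ a) *s l"
    by (intro vec_tendstoI) (auto intro!: tendsto_intros yr la)
  ultimately have "(x \<circ> r) \<longlonglongrightarrow> inverse (l $ a) *s l" by (simp add: o_def)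
  moreover have "inverse (l $ a) *s l \<in> chart_zeros a T0"
    using la \<open>\<And>k. quadric T0 k l = 0\<close> by (simp add: chart_zeros_def quadric_scale)
  ultimately show ?thesis using that lr(2) by blast
qed

text \<open>The term x_a - 1 makes the system square with invertible derivative. Carrying the
  parameter s along as a first component turns the local inverse of \<open>F\<close> into an
  implicit function of s.\<close>

lemma chart_zeros_implicit:
  fixes A B :: "('n::finite) tensor3"
  assumes AB: "A \<in> cyclic_symmetric_tensors" "B \<in> cyclic_symmetric_tensors"
    and reg: "regular a (A + s0 *s B)" and p: "p \<in> chart_zeros a (A + s0 *s B)" and "0 < e"
  obtains r d where "0 < r" "r \<le> e" "0 < d"
    "\<And>s. s \<in> ball s0 d \<Longrightarrow> \<exists>!x. x \<in> ball p r \<inter> chart_zeros a (A + s *s B)"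
proof -
  define F where "F z = (fst z, \<chi> k. quadric (A + fst z *s B) k (snd z)
      + of_bool (k = a) * (snd z $ a - 1))" for z :: "complex \<times> (complex ^ 'n)"
  define F' where "F' z h = (fst h, \<chi> k. (quadric_jacobian A (snd z) *v snd h) $ k
      + (fst z * (quadric_jacobian B (snd z) *v snd h) $ k + fst h * quadric B k (snd z))
      + of_bool (k = a) * snd h $ a)" for z h :: "complex \<times> (complex ^ 'n)"
  have dQ: "((\<lambda>z. quadric T k (snd z)) has_derivative (\<lambda>h. (quadric_jacobian T (snd z) *v snd h) $ k)) (at z)"
    if "T \<in> cyclic_symmetric_tensors" for T k and z :: "complex \<times> (complex ^ 'n)"
    by (rule has_derivative_compose[OF _ has_derivative_quadric[OF that]])
      (auto intro!: derivative_eq_intros)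
  have deriv: "(F has_derivative F' z) (at z)" for z
  proof -
    have "((\<lambda>z. quadric A k (snd z) + fst z * quadric B k (snd z) + of_bool (k = a) * (snd z $ a - 1))
        has_derivative (\<lambda>h. (quadric_jacobian A (snd z) *v snd h) $ k
        + (fst z * (quadric_jacobian B (snd z) *v snd h) $ k + fst h * quadric B k (snd z))
        + of_bool (k = a) * (snd h $ a - 0))) (at z)" for k
      by (intro has_derivative_add has_derivative_mult has_derivative_mult_right has_derivative_diff dQ AB
          has_derivative_const bounded_linear_imp_has_derivative bounded_linear_fst
          bounded_linear_compose[OF bounded_linear_vec_nth bounded_linear_snd])
    then show ?thesis
      unfolding F_def[abs_def] F'_def[abs_def]
      by (intro has_derivative_Pair has_derivative_vecI)
        (simp_all add: quadric_pencil bounded_linear_imp_has_derivative bounded_linear_fst)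
  qed
  then have bl: "bounded_linear (F' z)" for z by (rule has_derivative_bounded_linear)
  have app: "blinfun_apply (Blinfun (F' z)) = F' z" for z
    by (rule bounded_linear_Blinfun_apply[OF bl])
  have cont: "continuous_on UNIV (\<lambda>z. Blinfun (F' z))"
    by (intro continuous_on_blinfun_componentwise)
      (simp add: app F'_def, intro continuous_intros)
  have p1: "p $ a = 1" "\<And>k. quadric (A + s0 *s B) k p = 0"
    using p by (auto simp: chart_zeros_def)
  have "inj (F' (s0, p))"
  proof (rule linear_injective_0[THEN iffD2, OF bounded_linear.linear[OF bl], rule_format])
    fix h assume h: "F' (s0, p) h = 0"
    then have h1: "fst h = 0" by (simp add: F'_def zero_prod_def)
    \<comment> \<open>Because \<open>p $ a\<close> is 1, the derivative in the vector variable is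
      exactly the augmented Jacobian.\<close>
    have "augmented_jacobian a (A + s0 *s B) p *v snd h = 0"
      using h p1(1) by (auto simp: F'_def zero_prod_def vec_eq_iff augmented_jacobian_mult
          quadric_jacobian_pencil h1 of_bool_def split: if_splits)
    moreover have "p \<noteq> 0" using p1(1) by auto
    ultimately have "snd h = 0"
      using reg p1(2) unfolding regular_def by (metis det_nonzero_iff_kernel)
    then show "h = 0" using h1 by (simp add: prod_eq_iff)
  qed
  then obtain G where G: "linear G" "G \<circ> F' (s0, p) = id"
    using linear_injective_left_inverse[OF bounded_linear.linear[OF bl]] by blast
  have inv: "Blinfun G o\<^sub>L Blinfun (F' (s0, p)) = id_blinfun"
    using G by (intro blinfun_eqI)
      (simp add: app bounded_linear_Blinfun_apply linear_conv_bounded_linear pointfree_idE)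
  have "(F has_derivative blinfun_apply (Blinfun (F' z))) (at z)" for z
    unfolding app by (rule deriv)
  then obtain U V g where U: "open U" "(s0, p) \<in> U" and V: "open V" "F (s0, p) \<in> V"
    and hom: "homeomorphism U V F g"
    by (rule inverse_function_theorem[OF open_UNIV _ cont UNIV_I inv]) (rule that; assumption)
  have F0: "F (s, x) = (s, 0)" if "x \<in> chart_zeros a (A + s *s B)" for s x
    using that by (auto simp: F_def chart_zeros_def vec_eq_iff)
  \<comment> \<open>Weighting equation k by \<open>x $ k\<close> and summing cancels the quadrics
    and leaves x_a (x_a - 1) = 0.\<close>
  have zero: "x \<in> chart_zeros a (A + s *s B)" if x: "F (s, x) = (s, 0)" and xa: "x $ a \<noteq> 0" for s x
  proof -
    have eq: "quadric (A + s *s B) k x + of_bool (k = a) * (x $ a - 1) = 0" for k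
      using x by (simp add: F_def vec_eq_iff)
    have "0 = (\<Sum>k\<in>UNIV. x $ k * (quadric (A + s *s B) k x + of_bool (k = a) * (x $ a - 1)))"
      unfolding eq by simp
    also have "\<dots> = (\<Sum>k\<in>UNIV. if k = a then x $ k * (x $ a - 1) else 0)"
      using sum_coordinate_quadric[OF cyclic_symmetric_tensors_pencil[OF AB], of x s]
      by (simp add: distrib_left sum.distrib of_bool_def if_distrib[of "(*) _"]
          if_distrib[of "\<lambda>c. c * _"] cong: if_cong)
    finally have "x $ a = 1" using xa by simp
    then show ?thesis using eq by (simp add: chart_zeros_def)
  qed
  \<comment> \<open>The bound 1 on r keeps the open ball around \<open>p\<close> off the hyperplane
    where coordinate \<open>a\<close> vanishes.\<close>
  have "\<exists>r. 0 < r \<and> r \<le> e \<and> r \<le> 1 \<and> ball s0 r \<times> ball p r \<subseteq> U"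
  proof -
    obtain X Y where XY: "open X" "open Y" "s0 \<in> X" "p \<in> Y" "X \<times> Y \<subseteq> U"
      using open_prod_elim[OF U] by (metis mem_Sigma_iff)
    obtain r1 r2 where "0 < r1" "ball s0 r1 \<subseteq> X" "0 < r2" "ball p r2 \<subseteq> Y"
      using XY open_contains_ball by metis
    then show ?thesis using XY(5) \<open>0 < e\<close>
      by (intro exI[of _ "min (min r1 r2) (min e 1)"]) (auto simp: subset_iff)
  qed
  then obtain r where r: "0 < r" "r \<le> e" "r \<le> 1" "ball s0 r \<times> ball p r \<subseteq> U" by blast
  have V0: "(s0, 0) \<in> V" using V(2) F0[OF p] by simp
  have g0: "g (s0, 0) = (s0, p)"
    using hom U(2) F0[OF p] unfolding homeomorphism_def by metis
  have "isCont g (s0, 0)"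
    using hom V(1) V0 by (simp add: homeomorphism_def continuous_on_eq_continuous_at)
  moreover have "isCont (\<lambda>s. (s, 0 :: complex ^ 'n)) s0" by (intro continuous_intros)
  ultimately have gc: "isCont (\<lambda>s. g (s, 0)) s0"
    by (rule isCont_o2[rotated])
  have "open ((\<lambda>s. (s, 0 :: complex ^ 'n)) -` V)"
    by (intro open_vimage V(1) continuous_intros)
  then have "\<forall>\<^sub>F s in nhds s0. (s, 0) \<in> V"
    using V0 by (auto simp: eventually_nhds)
  moreover have "\<forall>\<^sub>F s in nhds s0. g (s, 0) \<in> ball s0 r \<times> ball p r"
  proof -
    have o: "open (ball s0 r \<times> ball p r)" by (intro open_Times open_ball)
    have i: "g (s0, 0) \<in> ball s0 r \<times> ball p r" using g0 r(1) by simp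
    show ?thesis
      unfolding eventually_nhds_conv_at
      by (rule conjI[OF topological_tendstoD[OF gc[unfolded isCont_def] o i] i])
  qed
  ultimately have "\<forall>\<^sub>F s in nhds s0. (s, 0) \<in> V \<and> g (s, 0) \<in> ball s0 r \<times> ball p r"
    by eventually_elim simp
  then obtain d where d: "0 < d"
    "\<And>s. dist s s0 < d \<Longrightarrow> (s, 0) \<in> V \<and> g (s, 0) \<in> ball s0 r \<times> ball p r"
    by (auto simp: eventually_nhds_metric)
  show ?thesis
  proof (rule that[of r "min d r"])
    show "0 < r" "r \<le> e" "0 < min d r" using r d(1) by auto
    fix s assume s: "s \<in> ball s0 (min d r)"
    obtain s' x where x: "g (s, 0) = (s', x)" by (cases "g (s, 0)")
    have gs: "(s, 0) \<in> V" "g (s, 0) \<in> ball s0 r \<times> ball p r"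
      using d(2)[of s] s by (auto simp: dist_commute)
    have "F (s', x) = (s, 0)"
      using hom gs(1) x unfolding homeomorphism_def by metis
    moreover from this have "s' = s" by (simp add: F_def)
    ultimately have Fx: "F (s, x) = (s, 0)" by simp
    have xr: "x \<in> ball p r" using gs(2) x by simp
    have near: "y $ a \<noteq> 0" if "y \<in> ball p r" for y
    proof
      assume "y $ a = 0"
      then have "norm ((p - y) $ a) = 1" using p1(1) by simp
      moreover have "norm ((p - y) $ a) \<le> norm (p - y)" by (rule Finite_Cartesian_Product.norm_nth_le)
      ultimately show False using that r(3) by (simp add: dist_norm)
    qed
    show "\<exists>!x. x \<in> ball p r \<inter> chart_zeros a (A + s *s B)"
    proof (rule ex1I[of _ x])
      show "x \<in> ball p r \<inter> chart_zeros a (A + s *s B)"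
        using zero[OF Fx near[OF xr]] xr by simp
      fix y assume y: "y \<in> ball p r \<inter> chart_zeros a (A + s *s B)"
      then have "F (s, y) = F (s, x)" using F0 Fx by simp
      moreover have "(s, y) \<in> U" "(s, x) \<in> U" using y xr r(4) s by auto
      ultimately show "y = x"
        using hom unfolding homeomorphism_def by (metis prod.inject)
    qed
  qed
qed

lemma finite_chart_zeros:
  assumes T: "T \<in> cyclic_symmetric_tensors" and reg: "regular a T"
  shows "finite (chart_zeros a T)"
proof (rule ccontr)
  assume "infinite (chart_zeros a T)"
  then obtain x :: "nat \<Rightarrow> _" where x: "inj x" "range x \<subseteq> chart_zeros a T"
    using infinite_countable_subset by blast
  obtain r l where rl: "strict_mono r" "l \<in> chart_zeros a T" "(x \<circ> r) \<longlonglongrightarrow> l"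
    using chart_zeros_compactness[OF reg tendsto_const, of x] x(2) by blast
  \<comment> \<open>With second tensor 0 the pencil is constant, and the implicit function lemma
    says that zeros are isolated.\<close>
  have 0: "0 \<in> cyclic_symmetric_tensors" by (simp add: cyclic_symmetric_tensors_def)
  have T0: "T + s *s 0 = T" for s by (simp add: vec_eq_iff)
  obtain e where ed: "0 < e" "\<exists>!x. x \<in> ball l e \<inter> chart_zeros a T"
  proof (rule chart_zeros_implicit[OF T 0, of a 0 l 1, unfolded T0, OF reg rl(2) zero_less_one])
    fix e d :: real
    assume "0 < e" "0 < d" and *: "\<And>s. s \<in> ball 0 d \<Longrightarrow> \<exists>!x. x \<in> ball l e \<inter> chart_zeros a T"
    show thesis
      by (rule that[OF \<open>0 < e\<close> *[of 0]]) (simp add: \<open>0 < d\<close>)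
  qed
  have "\<forall>\<^sub>F m in sequentially. (x \<circ> r) m \<in> ball l e"
    using rl(3) ed(1) by (auto simp: tendsto_iff dist_commute)
  then obtain N where N: "\<And>m. m \<ge> N \<Longrightarrow> x (r m) \<in> ball l e"
    by (auto simp: eventually_sequentially)
  then have "x (r N) \<in> ball l e \<inter> chart_zeros a T" "x (r (Suc N)) \<in> ball l e \<inter> chart_zeros a T"
    using x(2) by auto
  then have "x (r N) = x (r (Suc N))" using ed(2) by blast
  then show False
    using x(1) rl(1) by (metis inj_eq lessI less_irrefl strict_monoD)
qed

text \<open>Every zero at \<open>s0\<close> continues to exactly one zero nearby
  (\<open>uniq\<close>), and none appears elsewhere, not even from infinity
  (\<open>cover\<close>).\<close>

lemma card_chart_zeros_locally_constant:
  fixes A B :: "('n::finite) tensor3"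
  assumes AB: "A \<in> cyclic_symmetric_tensors" "B \<in> cyclic_symmetric_tensors"
    and reg: "regular a (A + s0 *s B)"
  shows "\<forall>\<^sub>F s in nhds s0. card (chart_zeros a (A + s *s B)) = card (chart_zeros a (A + s0 *s B))"
proof -
  define Z where "Z s = chart_zeros a (A + s *s B)" for s
  have fin: "finite (Z s0)"
    unfolding Z_def by (intro finite_chart_zeros cyclic_symmetric_tensors_pencil AB reg)
  \<comment> \<open>The factor 2 makes balls of radius at most e about distinct zeros disjoint. The
    1 inserted into the minimum below covers an empty zero set.\<close>
  have "\<exists>e>0. \<forall>p\<in>Z s0. \<forall>q\<in>Z s0. q \<noteq> p \<longrightarrow> 2 * e \<le> dist p q"
  proof -
    have "\<forall>p\<in>Z s0. \<exists>e>0. \<forall>q\<in>Z s0. q \<noteq> p \<longrightarrow> e \<le> dist p q"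
      using finite_set_avoid[OF fin] by blast
    then obtain e where e: "\<And>p. p \<in> Z s0 \<Longrightarrow> 0 < e p"
      "\<And>p q. p \<in> Z s0 \<Longrightarrow> q \<in> Z s0 \<Longrightarrow> q \<noteq> p \<Longrightarrow> e p \<le> dist p q" by metis
    have "\<exists>c>0. \<forall>p\<in>Z s0. c \<le> e p"
      using fin e(1) by (intro exI[of _ "Min (insert 1 (e ` Z s0))"]) auto
    then obtain c where "0 < c" "\<forall>p\<in>Z s0. c \<le> e p" by blast
    then show ?thesis using e(2) by (intro exI[of _ "c / 2"]) fastforce
  qed
  then obtain e where e: "0 < e" "\<And>p q. p \<in> Z s0 \<Longrightarrow> q \<in> Z s0 \<Longrightarrow> q \<noteq> p \<Longrightarrow> 2 * e \<le> dist p q"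
    by blast
  have "\<forall>p\<in>Z s0. \<exists>r d. 0 < r \<and> r \<le> e \<and> 0 < d \<and> (\<forall>s\<in>ball s0 d. \<exists>!x. x \<in> ball p r \<inter> Z s)"
  proof
    fix p assume p: "p \<in> Z s0"
    show "\<exists>r d. 0 < r \<and> r \<le> e \<and> 0 < d \<and> (\<forall>s\<in>ball s0 d. \<exists>!x. x \<in> ball p r \<inter> Z s)"
      using chart_zeros_implicit[OF AB reg p[unfolded Z_def] e(1)] unfolding Z_def by metis
  qed
  then obtain r d where rd: "\<And>p. p \<in> Z s0 \<Longrightarrow> 0 < r p" "\<And>p. p \<in> Z s0 \<Longrightarrow> r p \<le> e"
    "\<And>p. p \<in> Z s0 \<Longrightarrow> 0 < d p"
    "\<And>p s. p \<in> Z s0 \<Longrightarrow> s \<in> ball s0 (d p) \<Longrightarrow> \<exists>!x. x \<in> ball p (r p) \<inter> Z s"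
    by metis
  have uniq: "\<forall>\<^sub>F s in nhds s0. \<forall>p\<in>Z s0. \<exists>!x. x \<in> ball p (r p) \<inter> Z s"
  proof (rule eventually_ball_finite[OF fin], rule ballI)
    fix p assume "p \<in> Z s0"
    then show "\<forall>\<^sub>F s in nhds s0. \<exists>!x. x \<in> ball p (r p) \<inter> Z s"
      unfolding eventually_nhds_metric using rd(3,4) by (metis dist_commute mem_ball)
  qed
  \<comment> \<open>Zeros escaping all balls for parameters tending to \<open>s0\<close> would have
    a subsequence converging to a zero at \<open>s0\<close>, the centre of one of the balls.\<close>
  have cover: "\<forall>\<^sub>F s in nhds s0. Z s \<subseteq> (\<Union>p\<in>Z s0. ball p (r p))"
  proof (rule ccontr)
    assume "\<not> ?thesis"
    then have "\<forall>m. \<exists>s. dist s s0 < inverse (real (Suc m)) \<and> \<not> Z s \<subseteq> (\<Union>p\<in>Z s0. ball p (r p))"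
      unfolding eventually_nhds_metric by (metis inverse_positive_iff_positive of_nat_0_less_iff zero_less_Suc)
    then obtain \<sigma> where \<sigma>: "\<And>m. dist (\<sigma> m) s0 < inverse (real (Suc m))"
      "\<And>m. \<not> Z (\<sigma> m) \<subseteq> (\<Union>p\<in>Z s0. ball p (r p))" by metis
    have "\<forall>m. \<exists>x. x \<in> Z (\<sigma> m) \<and> x \<notin> (\<Union>p\<in>Z s0. ball p (r p))" using \<sigma>(2) by blast
    then obtain x where x: "\<And>m. x m \<in> Z (\<sigma> m)" "\<And>m. x m \<notin> (\<Union>p\<in>Z s0. ball p (r p))" by metis
    have "\<sigma> \<longlonglongrightarrow> s0"
      unfolding tendsto_dist_iff[of \<sigma>]
      by (rule tendsto_sandwich[OF _ _ tendsto_const LIMSEQ_inverse_real_of_nat])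
        (auto intro!: always_eventually less_imp_le \<sigma>(1) simp del: of_nat_Suc)
    then have "(\<lambda>m. A + \<sigma> m *s B) \<longlonglongrightarrow> A + s0 *s B"
      by (intro vec_tendstoI) (auto intro!: tendsto_intros)
    then obtain \<rho> l where l: "strict_mono \<rho>" "l \<in> Z s0" "(x \<circ> \<rho>) \<longlonglongrightarrow> l"
      using chart_zeros_compactness[OF reg, of "\<lambda>m. A + \<sigma> m *s B" x] x(1) unfolding Z_def by blast
    have "\<forall>\<^sub>F m in sequentially. (x \<circ> \<rho>) m \<in> ball l (r l)"
      using l(3) rd(1)[OF l(2)] by (auto simp: tendsto_iff dist_commute)
    then obtain m where "x (\<rho> m) \<in> ball l (r l)"
      by (auto simp: eventually_sequentially)
    then show False using x(2) l(2) by blast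
  qed
  from uniq cover have "\<forall>\<^sub>F s in nhds s0. card (Z s) = card (Z s0)"
  proof eventually_elim
    case (elim s)
    then obtain h where h: "\<And>p. p \<in> Z s0 \<Longrightarrow> h p \<in> ball p (r p) \<inter> Z s"
      by (metis (no_types, lifting))
    have "bij_betw h (Z s0) (Z s)"
      unfolding bij_betw_def
    proof
      show "inj_on h (Z s0)"
      proof (rule inj_onI, rule ccontr)
        fix p q assume pq: "p \<in> Z s0" "q \<in> Z s0" "h p = h q" "p \<noteq> q"
        then have "dist p (h p) < e" "dist q (h p) < e" using h rd(2) by fastforce+
        then have "dist p q < 2 * e" by (smt (verit) dist_commute dist_triangle)
        then show False using e(2)[OF pq(1,2)] pq(4) by simp
      qed
      show "h ` Z s0 = Z s"
      proof
        show "h ` Z s0 \<subseteq> Z s" using h by auto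
        show "Z s \<subseteq> h ` Z s0"
        proof
          fix x assume x: "x \<in> Z s"
          then obtain p where "p \<in> Z s0" "x \<in> ball p (r p)" using elim(2) by blast
          then have "x = h p" using elim(1) h x by blast
          then show "x \<in> h ` Z s0" using \<open>p \<in> Z s0\<close> by blast
        qed
      qed
    qed
    then show ?case by (simp add: bij_betw_same_card)
  qed
  then show ?thesis unfolding Z_def .
qed

text \<open>\<open>V\<close> is the incidence set of tensors and degenerate base points. Elimination
  confines the tensors that are not regular to the zero set of g, and \<open>chain_ideal\<close>
  ensures that the chain tensor is outside it.\<close>

lemma regular_polynomial:
  "\<exists>g. complex_poly_fun g \<and> g (chain_tensor :: ('n::finite) tensor3) \<noteq> 0
    \<and> (\<forall>T. g T \<noteq> 0 \<longrightarrow> regular (enum 0 :: 'n) T)"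
proof -
  define V where "V T x \<longleftrightarrow> (\<forall>k. quadric T k x = 0) \<and> det (augmented_jacobian (enum 0) T x) = 0"
    for T :: "'n tensor3" and x
  have "\<exists>F. form_family d F \<and> F chain_tensor = f \<and> (\<forall>T x. V T x \<longrightarrow> F T x = 0)"
    if "(d, f) \<in> chain_gens" for d and f :: "complex ^ 'n \<Rightarrow> complex"
  proof -
    from that consider "d = CARD('n)" "f = (\<lambda>x. det (augmented_jacobian (enum 0) chain_tensor x))"
      | k where "d = 2" "f = quadric chain_tensor k"
      by (auto simp: chain_gens_def)
    then show ?thesis
    proof cases
      case 1
      then show ?thesis
        by (intro exI[of _ "\<lambda>T x. det (augmented_jacobian (enum 0) T x)"])
          (simp add: form_family_det_augmented V_def)
    next
      case 2
      then show ?thesis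
        by (intro exI[of _ "\<lambda>T. quadric T k"]) (simp add: form_family_quadric V_def)
    qed
  qed
  moreover obtain N where "\<And>w. length w = N \<Longrightarrow> graded_ideal chain_gens N (monomial (w :: 'n list))"
    using chain_ideal by blast
  ultimately obtain g where "complex_poly_fun g" "g (chain_tensor :: 'n tensor3) \<noteq> 0"
    "\<And>T x. g T \<noteq> 0 \<Longrightarrow> V T x \<Longrightarrow> x = 0"
    using elimination[of N chain_gens chain_tensor V] by blast
  then show ?thesis unfolding regular_def V_def by blast
qed

text \<open>The complex line has real dimension 2, so deleting the finitely many roots does not
  disconnect it.\<close>

lemma connected_polynomial_nonzero:
  assumes "p \<noteq> (0 :: complex poly)"
  shows "connected {s. poly p s \<noteq> 0}"
proof -
  have "connected (UNIV - {s. poly p s = 0})"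
    using assms by (intro connected_open_delete_finite poly_roots_finite) auto
  moreover have "UNIV - {s. poly p s = 0} = {s. poly p s \<noteq> 0}" by auto
  ultimately show ?thesis by simp
qed

lemma card_chart_zeros_constant:
  fixes T0 T1 :: "('n::finite) tensor3"
  assumes T: "T0 \<in> cyclic_symmetric_tensors" "T1 \<in> cyclic_symmetric_tensors"
    and g: "complex_poly_fun g" "g T0 \<noteq> 0" "g T1 \<noteq> 0" "\<And>T. g T \<noteq> 0 \<Longrightarrow> regular a T"
  shows "card (chart_zeros a T1) = card (chart_zeros a T0)"
proof -
  define B where "B = T1 + (-1) *s T0"
  have B: "B \<in> cyclic_symmetric_tensors"
    unfolding B_def by (intro cyclic_symmetric_tensors_pencil T)
  have ends: "T0 + 0 *s B = T0" "T0 + 1 *s B = T1"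
    by (simp_all add: B_def vec_eq_iff)
  obtain p where p: "\<And>s. g (T0 + s *s B) = poly p s"
    using complex_poly_fun_line[OF g(1)] by blast
  have p01: "poly p 0 \<noteq> 0" "poly p 1 \<noteq> 0" using p[of 0] p[of 1] g ends by simp_all
  then have "p \<noteq> 0" by auto
  have "card (chart_zeros a (T0 + 1 *s B)) = card (chart_zeros a (T0 + 0 *s B))"
  proof (rule connected_local_const[OF connected_polynomial_nonzero[OF \<open>p \<noteq> 0\<close>], of 1 0])
    show "1 \<in> {s. poly p s \<noteq> 0}" "0 \<in> {s. poly p s \<noteq> 0}"
      using p01 by simp_all
    show "\<forall>s\<in>{s. poly p s \<noteq> 0}. \<forall>\<^sub>F t in at s within {s. poly p s \<noteq> 0}.
        card (chart_zeros a (T0 + s *s B)) = card (chart_zeros a (T0 + t *s B))"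
    proof
      fix s assume "s \<in> {s. poly p s \<noteq> 0}"
      then have "regular a (T0 + s *s B)" using g(4) p by simp
      from card_chart_zeros_locally_constant[OF T(1) B this]
      show "\<forall>\<^sub>F t in at s within {s. poly p s \<noteq> 0}.
        card (chart_zeros a (T0 + s *s B)) = card (chart_zeros a (T0 + t *s B))"
        unfolding eventually_at_filter by eventually_elim simp
    qed
  qed
  then show ?thesis by (simp only: ends)
qed

theorem theorem4p4:
  "\<exists>U :: ('n::finite) tensor3 set.
     U \<noteq> {} \<and> zariski_open_in cyclic_symmetric_tensors U \<and>
     (\<forall>T\<in>U.
        finite (base_points (quadric T)) \<and>
        card (base_points (quadric T)) = jacobsthal CARD('n) \<and>
        (infinite (weddle_singular_points (quadric T)) \<or>
         jacobsthal CARD('n) \<le> card (weddle_singular_points (quadric T))))"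
proof -
  let ?a = "enum 0 :: 'n"
  obtain g where g: "complex_poly_fun g" "g (chain_tensor :: 'n tensor3) \<noteq> 0"
    "\<And>T. g T \<noteq> 0 \<Longrightarrow> regular ?a T"
    using regular_polynomial by blast
  define U where "U = cyclic_symmetric_tensors - {T. \<forall>f\<in>{g}. f T = 0}"
  have "chain_tensor \<in> U"
    using g(2) chain_tensor_cyclic by (simp add: U_def)
  moreover have "zariski_open_in cyclic_symmetric_tensors U"
    unfolding zariski_open_in_def U_def using g(1) by blast
  moreover have "finite (base_points (quadric T)) \<and>
      card (base_points (quadric T)) = jacobsthal CARD('n) \<and>
      (infinite (weddle_singular_points (quadric T)) \<or>
        jacobsthal CARD('n) \<le> card (weddle_singular_points (quadric T)))" if "T \<in> U" for T
  proof -
    have T: "T \<in> cyclic_symmetric_tensors" "g T \<noteq> 0" using that by (auto simp: U_def)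
    have reg: "regular ?a T" using g(3) T(2) .
    have bij: "bij_betw (\<lambda>x. vec.span {x}) (chart_zeros ?a T) (base_points (quadric T))"
      using regular_coordinate[OF reg] by (intro bij_betw_chart_zeros_base_points) blast
    have fin: "finite (base_points (quadric T))"
      using bij_betw_finite[OF bij] finite_chart_zeros[OF T(1) reg] by simp
    have "card (chart_zeros ?a T) = jacobsthal CARD('n)"
      using card_chart_zeros_constant[OF chain_tensor_cyclic T(1) g(1,2) T(2) g(3)]
        card_chart_zeros_chain_tensor(2) by simp
    then have card: "card (base_points (quadric T)) = jacobsthal CARD('n)"
      using bij_betw_same_card[OF bij] by simp
    then show ?thesis
      using fin card_mono[OF _ base_points_subset_weddle_singular_points[OF T(1)]] by auto
  qed
  ultimately show ?thesis by blast
qed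

end
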